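(* Let $\delta_n\downarrow0$ and suppose $[v_n,v_n+\delta_n]$ remains in a compact interior subset of $\mathcal K$. If $H_n\to\infty$ and \[ H_n^6\,\eta_{0,n}(H_n)\to0,\qquad \eta_{1,n}(H_n)\to0,\qquad H_n^{10}\,\delta_n\to0, \] then, under the Differentiated Gaussian Transfer assumption stated in the context, \[ R^E_{n,H_n}(v_n+\delta_n)-R^E_{n,H_n}(v_n)=\delta_n\{1+o(1)\}. \] The conclusion is uniform when the constants in that assumption are uniform.
   Context: Gaussian reference: for $v>0$, $Y=h+\sqrt v\,Z$, $Z\sim N(0,1)$, $|h|\le H$; for a prior $\pi$ on $[-H,H]$, $r^G_v(\pi)$ is the Bayes risk for estimating $h$ under squared error, $w^G_v(Y)$ the posterior variance of $h$, and $\mathbb E^G$ the expectation with $h\sim\pi$. $\mathcal K$ is a compact subset (interval) of $(0,\infty)$. For $v\in\mathcal K$, $\mathcal E_{n,H}(v)=\{P_{n,v,h}:|h|\le H\}$ are local experiments for the identity target $h$, with squared-error minimax risk $R^E_{n,H}(v)$ and Bayes risk $r^E_{n,v}(\pi)$. Differentiated Gaussian Transfer assumption: uniformly over $v\in\mathcal K$, all priors $\pi$ on $[-H,H]$, and the stated range $H=H_n$: (1) $R^E_{n,H}(v)=\sup_\pi r^E_{n,v}(\pi)$ (supremum over priors on $[-H,H]$), with an attaining least-favorable prior; (2) every Bayes risk is differentiable in $v$ and $0\le\partial_vr^E_{n,v}(\pi)\le C_{\mathcal K}H^4$; (3) there are deterministic errors $\eta_{0,n}(H),\eta_{1,n}(H)$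 such that $|r^E_{n,v}(\pi)-r^G_v(\pi)|\le\eta_{0,n}(H)$ and $\big|\partial_vr^E_{n,v}(\pi)-\mathbb E^G[(w^G_v(Y)/v)^2]\big|\le\eta_{1,n}(H)$. *)

theory Defs
  imports "HOL-Probability.Probability"
begin

text \<open>
  Priors on \<open>[-H, H]\<close> live on the Borel \<open>\<sigma>\<close>-algebra of the interval itself, so the laws
  \<open>P h\<close> of an experiment have to be given (and be measurable in \<open>h\<close>) only for \<open>\<bar>h\<bar> \<le> H\<close>.
\<close>

definition priors :: "real \<Rightarrow> real measure set" where
  "priors H = space (prob_algebra (restrict_space borel {-H..H}))"

text \<open>
  A local experiment \<open>{P h : \<bar>h\<bar> \<le> H}\<close> on the sample space \<open>S\<close>: a Markov kernel
  from \<open>[-H, H]\<close> to \<open>S\<close>.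
\<close>

definition local_experiment :: "'a measure \<Rightarrow> real \<Rightarrow> (real \<Rightarrow> 'a measure) \<Rightarrow> bool" where
  "local_experiment S H P \<longleftrightarrow> P \<in> restrict_space borel {-H..H} \<rightarrow>\<^sub>M prob_algebra S"

definition sq_risk :: "(real \<Rightarrow> 'a measure) \<Rightarrow> ('a \<Rightarrow> real) \<Rightarrow> real \<Rightarrow> ennreal" where
  "sq_risk P d h = (\<integral>\<^sup>+ x. ennreal ((d x - h)\<^sup>2) \<partial>P h)"

text \<open>
  Individual estimators may have infinite risk; both infima below are at most \<open>H\<^sup>2\<close>
  (take \<open>d = 0\<close>), so nothing is lost in the passage to the reals.
\<close>

definition minimax_risk :: "'a measure \<Rightarrow> real \<Rightarrow> (real \<Rightarrow> 'a measure) \<Rightarrow> real" where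
  "minimax_risk S H P =
     enn2real (INF d \<in> borel_measurable S. SUP h \<in> {-H..H}. sq_risk P d h)"

definition bayes_risk :: "'a measure \<Rightarrow> (real \<Rightarrow> 'a measure) \<Rightarrow> real measure \<Rightarrow> real" where
  "bayes_risk S P \<pi> =
     enn2real (INF d \<in> borel_measurable S. \<integral>\<^sup>+ h. sq_risk P d h \<partial>\<pi>)"

text \<open>The Gaussian reference: \<open>gauss_law v h\<close> is the law of \<open>Y = h + sqrt v * Z\<close>.\<close>

definition gauss_law :: "real \<Rightarrow> real \<Rightarrow> real measure" where
  "gauss_law v h = density lborel (\<lambda>y. ennreal (normal_density h (sqrt v) y))"

definition gauss_bayes_risk :: "real \<Rightarrow> real measure \<Rightarrow> real" where
  "gauss_bayes_risk v \<pi> = bayes_risk borel (gauss_law v) \<pi>"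

definition gauss_posterior :: "real \<Rightarrow> real measure \<Rightarrow> real \<Rightarrow> real measure" where
  "gauss_posterior v \<pi> y =
     density \<pi> (\<lambda>h. ennreal (normal_density h (sqrt v) y /
                       (\<integral>h'. normal_density h' (sqrt v) y \<partial>\<pi>)))"

definition gauss_posterior_mean :: "real \<Rightarrow> real measure \<Rightarrow> real \<Rightarrow> real" where
  "gauss_posterior_mean v \<pi> y = (\<integral>h. h \<partial>gauss_posterior v \<pi> y)"

definition gauss_posterior_var :: "real \<Rightarrow> real measure \<Rightarrow> real \<Rightarrow> real" where
  "gauss_posterior_var v \<pi> y =
     (\<integral>h. (h - gauss_posterior_mean v \<pi> y)\<^sup>2 \<partial>gauss_posterior v \<pi> y)"

definition gauss_expectation :: "real \<Rightarrow> real measure \<Rightarrow> (real \<Rightarrow> real) \<Rightarrow> real" where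
  "gauss_expectation v \<pi> g = (\<integral>h. (\<integral>y. g y \<partial>gauss_law v h) \<partial>\<pi>)"

text \<open>
  The differentiated Gaussian transfer assumption along the radii \<open>H n\<close>. The constant \<open>C\<close> and
  the errors \<open>\<eta>0 n (H n)\<close>, \<open>\<eta>1 n (H n)\<close> depend neither on \<open>v\<close> nor on the prior.
  The derivative in \<open>v\<close> is taken relative to \<open>K\<close>: it is the ordinary one at interior points
  and one-sided at the endpoints of the interval \<open>K\<close>.
\<close>

definition differentiated_gaussian_transfer ::
  "real set \<Rightarrow> (nat \<Rightarrow> real) \<Rightarrow> real \<Rightarrow> (nat \<Rightarrow> real \<Rightarrow> real) \<Rightarrow> (nat \<Rightarrow> real \<Rightarrow> real)
   \<Rightarrow> (nat \<Rightarrow> 'a measure) \<Rightarrow> (nat \<Rightarrow> real \<Rightarrow> real \<Rightarrow> 'a measure) \<Rightarrow> bool" where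
  "differentiated_gaussian_transfer K H C \<eta>0 \<eta>1 S P \<longleftrightarrow>
     (\<forall>n. \<forall>v\<in>K.
        minimax_risk (S n) (H n) (P n v) = (SUP \<pi>\<in>priors (H n). bayes_risk (S n) (P n v) \<pi>) \<and>
        (\<exists>\<pi>\<in>priors (H n). bayes_risk (S n) (P n v) \<pi> = minimax_risk (S n) (H n) (P n v)) \<and>
        (\<forall>\<pi>\<in>priors (H n).
           \<bar>bayes_risk (S n) (P n v) \<pi> - gauss_bayes_risk v \<pi>\<bar> \<le> \<eta>0 n (H n) \<and>
           (\<exists>D. ((\<lambda>u. bayes_risk (S n) (P n u) \<pi>) has_real_derivative D) (at v within K) \<and>
                0 \<le> D \<and> D \<le> C * H n ^ 4 \<and>
                \<bar>D - gauss_expectation v \<pi> (\<lambda>y. (gauss_posterior_var v \<pi> y / v)\<^sup>2)\<bar>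
                  \<le> \<eta>1 n (H n))))"

end

theory Submission
  imports Defs
begin

text \<open>
  Write \<open>u = v + \<delta>\<close> and \<open>g(\<xi>)\<close> for the Gaussian expectation of the squared relative posterior
  variance. Evaluating both Bayes risks at a prior least favorable at \<open>u\<close> (resp. at \<open>v\<close>)
  bounds the increment of the minimax risk from above (resp. below) by \<open>\<delta>\<close> times a derivative,
  hence by \<open>\<delta> * g(\<xi>)\<close> up to \<open>\<eta>1\<close>.

  Upper bound: for a prior least favorable at \<open>u\<close>, the Bayes risk grows on \<open>[u, u + t]\<close> at most
  as much as the minimax risk does, which by rescaling priors is at most \<open>t + 2 * \<eta>0\<close>. So
  \<open>g \<le> 1 + 2 * \<eta>0 / t + \<eta>1\<close> somewhere in \<open>[u, u + t]\<close>. As \<open>g\<close> is Lipschitz with a constant of order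
  \<open>H\<^sup>4\<close>, the choice \<open>t = 1 / H\<^sup>5\<close> carries this bound back to \<open>[v, u]\<close>.

  Lower bound: \<open>g(\<xi>) \<ge> 2 * r / \<xi> - 1\<close>, where \<open>r\<close> is the Gaussian Bayes risk at \<open>\<xi>\<close>. For a prior least
  favorable at \<open>v\<close>, \<open>r\<close> is up to \<open>2 * \<eta>0\<close> at least the Gaussian risk at \<open>v\<close> of a truncated
  normal prior, which tends to \<open>v\<close>.
\<close>

section \<open>Estimates and identities for normal densities\<close>

text \<open>Follows from \<open>exp z \<ge> 1 + z\<close>. Taking the sum of both exponentials keeps
  the bound symmetric and, for densities, easy to integrate.\<close>

lemma abs_exp_diff_le: "\<bar>exp x - exp y\<bar> \<le> \<bar>x - y\<bar> * (exp x + exp y)" for x y :: real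
proof -
  have *: "exp x - exp y \<le> (x - y) * (exp x + exp y)" if "y \<le> x" for x y :: real
  proof -
    have "1 - exp (y - x) \<le> x - y"
      using exp_ge_add_one_self[of "y - x"] by linarith
    hence "exp x * (1 - exp (y - x)) \<le> exp x * (x - y)"
      by (intro mult_left_mono) auto
    also have "\<dots> \<le> (x - y) * (exp x + exp y)"
      using that by (simp add: algebra_simps mult_right_mono)
    finally show ?thesis by (simp add: exp_diff algebra_simps)
  qed
  show ?thesis
    using *[of x y] *[of y x] by (cases "y \<le> x") (auto simp: abs_if algebra_simps)
qed

lemma borel_measurable_normal_density_compose [measurable]:
  assumes [measurable]: "f \<in> borel_measurable M" "g \<in> borel_measurable M"
  shows "(\<lambda>x. normal_density (f x) s (g x)) \<in> borel_measurable M"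
  unfolding normal_density_def by measurable

lemma normal_density_le:
  assumes "0 < v"
  shows "normal_density h (sqrt v) y \<le> 1 / sqrt (2 * pi * v)"
proof -
  have "1 / sqrt (2 * pi * v) * exp (- (y - h)\<^sup>2 / (2 * v)) \<le> 1 / sqrt (2 * pi * v) * 1"
    using assms by (intro mult_left_mono) auto
  thus ?thesis using assms by (simp add: normal_density_def)
qed

lemma normal_density_eq_exp:
  assumes "0 < v"
  shows "normal_density h (sqrt v) y = exp (- ln (2 * pi * v) / 2 - (y - h)\<^sup>2 / (2 * v))"
proof -
  have "sqrt (2 * pi * v) = exp (ln (2 * pi * v) / 2)"
    using assms by (simp flip: ln_sqrt)
  hence "exp (- ln (2 * pi * v) / 2) = 1 / sqrt (2 * pi * v)"
    by (simp add: exp_minus inverse_eq_divide)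
  thus ?thesis
    using assms by (simp add: normal_density_def exp_diff exp_minus inverse_eq_divide)
qed

lemma normal_density_second_moment:
  assumes "0 < v"
  shows "has_bochner_integral lborel (\<lambda>y. normal_density h (sqrt v) y * (y - h)\<^sup>2) v"
  using normal_moment_even[of "sqrt v" h 1] assms by (simp add: fact_numeral)

lemma normal_density_fourth_moment:
  assumes "0 < v"
  shows "has_bochner_integral lborel (\<lambda>y. normal_density h (sqrt v) y * (y - h) ^ 4) (3 * v\<^sup>2)"
  using normal_moment_even[of "sqrt v" h 2] assms
  by (simp add: fact_numeral power2_eq_square field_simps)

text \<open>The log-density is Lipschitz in the noise level: above \<open>a\<close>, the logarithm
  has Lipschitz constant \<open>1 / a\<close> and the reciprocal \<open>1 / a\<^sup>2\<close>.
  \<open>abs_exp_diff_le\<close> then passes from exponents to densities.\<close>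

lemma normal_density_diff_le:
  assumes a: "0 < a" "a \<le> v" "a \<le> v'"
  shows "\<bar>normal_density h (sqrt v) y - normal_density h (sqrt v') y\<bar>
    \<le> \<bar>v - v'\<bar> * (1 / (2 * a) + (y - h)\<^sup>2 / (2 * a\<^sup>2)) *
      (normal_density h (sqrt v) y + normal_density h (sqrt v') y)"
proof -
  have pos: "0 < v" "0 < v'" using a by auto
  have ln_le: "\<bar>ln x - ln y\<bar> \<le> \<bar>x - y\<bar> / a" if "a \<le> x" "a \<le> y" for x y
  proof -
    have *: "ln x - ln y \<le> (x - y) / a" if "a \<le> y" "y \<le> x" for x y
    proof -
      have "ln x - ln y = ln (x / y)" using a that by (simp add: ln_div)
      also have "\<dots> \<le> x / y - 1" using a that by (intro ln_le_minus_one) auto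
      also have "\<dots> = (x - y) / y" using a that by (simp add: field_simps)
      also have "\<dots> \<le> (x - y) / a" using a that by (intro divide_left_mono) auto
      finally show ?thesis .
    qed
    have mono: "ln x \<le> ln y \<longleftrightarrow> x \<le> y" "ln y \<le> ln x \<longleftrightarrow> y \<le> x" using a that by auto
    show ?thesis using *[of x y] *[of y x] that mono by (cases "x \<le> y") (auto simp: abs_if)
  qed
  have inv_le: "\<bar>1 / v - 1 / v'\<bar> \<le> \<bar>v - v'\<bar> / a\<^sup>2"
  proof -
    have "\<bar>1 / v - 1 / v'\<bar> = \<bar>v - v'\<bar> / (v * v')"
    proof -
      have "1 / v - 1 / v' = (v' - v) / (v * v')" using pos by (simp add: field_simps)
      thus ?thesis using pos by (simp add: abs_minus_commute)
    qed
    also have "\<dots> \<le> \<bar>v - v'\<bar> / a\<^sup>2"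
      using a unfolding power2_eq_square by (intro divide_left_mono mult_mono) auto
    finally show ?thesis .
  qed
  let ?l = "\<lambda>v. - ln (2 * pi * v) / 2 - (y - h)\<^sup>2 / (2 * v)"
  have "?l v - ?l v' = - (ln v - ln v') / 2 - (y - h)\<^sup>2 / 2 * (1 / v - 1 / v')"
    using pos by (simp add: ln_mult field_simps)
  hence "\<bar>?l v - ?l v'\<bar> \<le> \<bar>ln v - ln v'\<bar> / 2 + (y - h)\<^sup>2 / 2 * \<bar>1 / v - 1 / v'\<bar>"
    using abs_triangle_ineq4[of "- (ln v - ln v') / 2" "(y - h)\<^sup>2 / 2 * (1 / v - 1 / v')"]
    by (simp add: abs_mult abs_minus_commute)
  also have "\<dots> \<le> (\<bar>v - v'\<bar> / a) / 2 + (y - h)\<^sup>2 / 2 * (\<bar>v - v'\<bar> / a\<^sup>2)"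
    using ln_le[of v v'] inv_le a by (intro add_mono mult_left_mono) auto
  also have "\<dots> = \<bar>v - v'\<bar> * (1 / (2 * a) + (y - h)\<^sup>2 / (2 * a\<^sup>2))"
    by (simp add: algebra_simps)
  finally show ?thesis
    unfolding normal_density_eq_exp[OF pos(1)] normal_density_eq_exp[OF pos(2)]
    by (intro order_trans[OF abs_exp_diff_le] mult_right_mono) auto
qed

text \<open>Integrating the pointwise bound uses total mass one and second moments at most
  \<open>b\<close>. The constant is free of \<open>h\<close>, so the bound survives averaging over
  any prior.\<close>

lemma normal_density_L1_dist_le:
  assumes a: "0 < a" "v \<in> {a..b}" "v' \<in> {a..b}"
  shows "(\<integral>y. \<bar>normal_density h (sqrt v) y - normal_density h (sqrt v') y\<bar> \<partial>lborel)
    \<le> (1 / a + b / a\<^sup>2) * \<bar>v - v'\<bar>"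
proof -
  have pos: "0 < v" "0 < v'" using a by auto
  let ?q = "\<lambda>v y. normal_density h (sqrt v) y"
  have I0: "has_bochner_integral lborel (?q u) 1" if "0 < u" for u
    using integral_normal_density[of "sqrt u" h] integrable_normal_density[of "sqrt u" h] that
    by (auto simp: has_bochner_integral_iff)
  let ?g = "\<lambda>y. \<bar>v - v'\<bar> * (1 / (2 * a) * (?q v y + ?q v' y)
                 + 1 / (2 * a\<^sup>2) * (?q v y * (y - h)\<^sup>2 + ?q v' y * (y - h)\<^sup>2))"
  have G: "has_bochner_integral lborel ?g
     (\<bar>v - v'\<bar> * (1 / (2 * a) * (1 + 1) + 1 / (2 * a\<^sup>2) * (v + v')))"
    by (intro has_bochner_integral_mult_right has_bochner_integral_add I0
          normal_density_second_moment pos)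
  have "(\<integral>y. \<bar>?q v y - ?q v' y\<bar> \<partial>lborel) \<le> (\<integral>y. ?g y \<partial>lborel)"
  proof (rule integral_mono)
    show "integrable lborel (\<lambda>y. \<bar>?q v y - ?q v' y\<bar>)"
      using pos by (intro integrable_abs Bochner_Integration.integrable_diff) auto
    show "integrable lborel ?g" using G by (rule integrable.intros)
    show "\<bar>?q v y - ?q v' y\<bar> \<le> ?g y" for y
      using normal_density_diff_le[of a v v' h y] a
      by (simp add: algebra_simps add_divide_distrib)
  qed
  also have "\<dots> = \<bar>v - v'\<bar> * (1 / (2 * a) * (1 + 1) + 1 / (2 * a\<^sup>2) * (v + v'))"
    using G by (rule has_bochner_integral_integral_eq)
  also have "\<dots> \<le> \<bar>v - v'\<bar> * (1 / (2 * a) * (1 + 1) + 1 / (2 * a\<^sup>2) * (b + b))"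
    using a by (intro mult_left_mono add_mono) auto
  also have "\<dots> = (1 / a + b / a\<^sup>2) * \<bar>v - v'\<bar>" by (simp add: field_simps)
  finally show ?thesis .
qed

text \<open>Conjugacy of the normal prior: the joint density of parameter and observation factors
  into the marginal N(0, s + v) of \<open>y\<close> and the normal posterior of \<open>h\<close>. In
  the exponent this is completing the square.\<close>

lemma normal_density_mult:
  assumes "0 < s" "0 < v"
  shows "normal_density 0 (sqrt s) h * normal_density h (sqrt v) y =
    normal_density 0 (sqrt (s + v)) y *
    normal_density (s * y / (s + v)) (sqrt (s * v / (s + v))) h"
proof -
  have sqrt: "sqrt (2 * pi * (s + v)) * sqrt (2 * pi * (s * v / (s + v))) =
      sqrt (2 * pi * s) * sqrt (2 * pi * v)"
    using assms by (simp add: real_sqrt_mult[symmetric])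
  have "h\<^sup>2 / (2 * s) + (y - h)\<^sup>2 / (2 * v) =
      y\<^sup>2 / (2 * (s + v)) + (h - s * y / (s + v))\<^sup>2 / (2 * (s * v / (s + v)))"
  proof -
    define n where "n = s + v"
    have nz: "n \<noteq> 0" "s \<noteq> 0" "v \<noteq> 0" using assms by (auto simp: n_def)
    have "h\<^sup>2 / (2 * s) + (y - h)\<^sup>2 / (2 * v) = (h\<^sup>2 * v * n + (y - h)\<^sup>2 * s * n) / (2 * s * v * n)"
      using nz by (simp add: field_simps)
    also have "h\<^sup>2 * v * n + (y - h)\<^sup>2 * s * n = y\<^sup>2 * s * v + (h * n - s * y)\<^sup>2"
      by (simp add: n_def power2_eq_square algebra_simps)
    also have "(y\<^sup>2 * s * v + (h * n - s * y)\<^sup>2) / (2 * s * v * n) =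
        y\<^sup>2 / (2 * n) + (h * n - s * y)\<^sup>2 / (2 * s * v * n)"
      using nz by (simp add: field_simps)
    also have "(h * n - s * y)\<^sup>2 / (2 * s * v * n) = (h - s * y / n)\<^sup>2 / (2 * (s * v / n))"
    proof -
      have "h * n - s * y = n * (h - s * y / n)" using nz by (simp add: field_simps)
      thus ?thesis using nz by (simp add: power_mult_distrib) (simp add: power2_eq_square)
    qed
    finally show ?thesis unfolding n_def .
  qed
  hence "exp (- h\<^sup>2 / (2 * s)) * exp (- (y - h)\<^sup>2 / (2 * v)) =
    exp (- y\<^sup>2 / (2 * (s + v))) * exp (- (h - s * y / (s + v))\<^sup>2 / (2 * (s * v / (s + v))))"
    by (simp add: mult_exp_exp)
  thus ?thesis
    using assms sqrt by (simp add: normal_density_def)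
qed

section \<open>Posteriors for bounded priors\<close>

locale gauss_prior =
  fixes \<pi> :: "real measure" and H :: real
  assumes prior: "\<pi> \<in> priors H"
begin

lemma sets_prior [measurable_cong, simp]: "sets \<pi> = sets (restrict_space borel {-H..H})"
  using prior by (auto simp: priors_def space_prob_algebra)

lemma space_prior [simp]: "space \<pi> = {-H..H}"
  using sets_eq_imp_space_eq[OF sets_prior] by (simp add: space_restrict_space)

sublocale prob_space \<pi>
  using prior by (auto simp: priors_def space_prob_algebra)

sublocale pair_sigma_finite \<pi> lborel
  by unfold_locales

lemma prob_radius [simp]: "prob {-H..H} = 1"
  using prob_space by simp

lemma measurable_prior: "f \<in> borel_measurable borel \<Longrightarrow> f \<in> borel_measurable \<pi>"
  using measurable_restrict_space1[of f borel borel "{-H..H}"]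
  unfolding measurable_cong_sets[OF sets_prior refl] .

lemma measurable_prior_ident [measurable]: "(\<lambda>h. h) \<in> borel_measurable \<pi>"
  by (rule measurable_prior) simp

lemma integrable_prior:
  fixes f :: "real \<Rightarrow> real"
  assumes "f \<in> borel_measurable \<pi>" "\<And>h. h \<in> {-H..H} \<Longrightarrow> \<bar>f h\<bar> \<le> B"
  shows "integrable \<pi> f"
  using assms by (intro integrable_const_bound[of _ B]) auto

text \<open>The Lebesgue density of the observation when \<open>h\<close> is drawn from
  \<open>\<pi>\<close>.\<close>

definition marg :: "real \<Rightarrow> real \<Rightarrow> real" where
  "marg v y = (\<integral>h. normal_density h (sqrt v) y \<partial>\<pi>)"

abbreviation post_mean :: "real \<Rightarrow> real \<Rightarrow> real" where
  "post_mean v y \<equiv> gauss_posterior_mean v \<pi> y"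

abbreviation post_var :: "real \<Rightarrow> real \<Rightarrow> real" where
  "post_var v y \<equiv> gauss_posterior_var v \<pi> y"

context
  fixes v :: real
  assumes v: "0 < v"
begin

lemma integrable_mult_density:
  fixes f :: "real \<Rightarrow> real"
  assumes [measurable]: "f \<in> borel_measurable \<pi>" and B: "\<And>h. h \<in> {-H..H} \<Longrightarrow> \<bar>f h\<bar> \<le> B"
  shows "integrable \<pi> (\<lambda>h. f h * normal_density h (sqrt v) y)"
proof (rule integrable_prior)
  show "\<bar>f h * normal_density h (sqrt v) y\<bar> \<le> B * (1 / sqrt (2 * pi * v))" if "h \<in> {-H..H}" for h
    unfolding abs_mult using B[OF that] normal_density_le[OF v, of h y]
    by (intro mult_mono) auto
qed measurable

lemma integrable_density: "integrable \<pi> (\<lambda>h. normal_density h (sqrt v) y)"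
  using integrable_mult_density[of "\<lambda>_. 1" 1 y] by simp

lemma marg_pos: "0 < marg v y"
proof -
  have "(\<integral>h. 0 \<partial>\<pi>) < marg v y"
    unfolding marg_def
    using v normal_density_pos[of "sqrt v"] emeasure_space_1
    by (intro integral_less_AE_space integrable_density) auto
  thus ?thesis by simp
qed

lemma measurable_marg [measurable]: "marg v \<in> borel_measurable borel"
  unfolding marg_def[abs_def] by measurable

lemma integral_posterior:
  fixes f :: "real \<Rightarrow> real"
  assumes [measurable]: "f \<in> borel_measurable \<pi>"
  shows "integral\<^sup>L (gauss_posterior v \<pi> y) f = (\<integral>h. f h * normal_density h (sqrt v) y \<partial>\<pi>) / marg v y"
proof -
  have "integral\<^sup>L (gauss_posterior v \<pi> y) f =
      (\<integral>h. (normal_density h (sqrt v) y / marg v y) *\<^sub>R f h \<partial>\<pi>)"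
    unfolding gauss_posterior_def marg_def[symmetric]
    using marg_pos[of y] by (intro integral_density) (auto intro!: AE_I2)
  also have "\<dots> = (\<integral>h. f h * normal_density h (sqrt v) y / marg v y \<partial>\<pi>)"
    by (simp add: mult.commute)
  finally show ?thesis by simp
qed

lemma abs_post_mean_le: "\<bar>post_mean v y\<bar> \<le> H"
proof -
  have "\<bar>\<integral>h. h * normal_density h (sqrt v) y \<partial>\<pi>\<bar> \<le> (\<integral>h. \<bar>h * normal_density h (sqrt v) y\<bar> \<partial>\<pi>)"
    by (rule integral_abs_bound)
  also have "\<dots> \<le> (\<integral>h. H * normal_density h (sqrt v) y \<partial>\<pi>)"
    by (intro integral_mono integrable_abs integrable_mult_density[where B = H])
       (auto simp: abs_mult intro!: mult_right_mono)
  finally have "\<bar>\<integral>h. h * normal_density h (sqrt v) y \<partial>\<pi>\<bar> \<le> H * marg v y"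
    by (simp add: marg_def)
  thus ?thesis
    unfolding gauss_posterior_mean_def using marg_pos[of y]
    by (simp add: integral_posterior divide_le_eq)
qed

lemma sq_diff_le:
  assumes "\<bar>c\<bar> \<le> H" "h \<in> {-H..H}"
  shows "(h - c)\<^sup>2 \<le> 4 * H\<^sup>2"
proof -
  have "\<bar>h - c\<bar> \<le> \<bar>2 * H\<bar>" using assms by auto
  hence "(h - c)\<^sup>2 \<le> (2 * H)\<^sup>2" by (subst abs_le_square_iff[symmetric])
  thus ?thesis by (simp add: power_mult_distrib)
qed

lemma integrable_sq_density:
  assumes "\<bar>c\<bar> \<le> H"
  shows "integrable \<pi> (\<lambda>h. (h - c)\<^sup>2 * normal_density h (sqrt v) y)"
  using sq_diff_le[OF assms] by (intro integrable_mult_density[where B = "4 * H\<^sup>2"]) auto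

text \<open>Multiplying by \<open>marg\<close> clears the denominator of the posterior. Noise levels
  are later compared through such products, so quotients by a possibly tiny marginal need not be
  estimated.\<close>

lemma marg_mult_post_mean:
  "marg v y * post_mean v y = (\<integral>h. h * normal_density h (sqrt v) y \<partial>\<pi>)"
  unfolding gauss_posterior_mean_def using marg_pos[of y] by (simp add: integral_posterior)

lemma marg_mult_post_var:
  "marg v y * post_var v y = (\<integral>h. (h - post_mean v y)\<^sup>2 * normal_density h (sqrt v) y \<partial>\<pi>)"
  unfolding gauss_posterior_var_def using marg_pos[of y] by (simp add: integral_posterior)

lemma measurable_post_mean [measurable]: "post_mean v \<in> borel_measurable borel"
proof -
  have "post_mean v = (\<lambda>y. (\<integral>h. h * normal_density h (sqrt v) y \<partial>\<pi>) / marg v y)"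
    unfolding gauss_posterior_mean_def by (simp add: integral_posterior)
  thus ?thesis by simp
qed

lemma measurable_post_var [measurable]: "post_var v \<in> borel_measurable borel"
proof -
  have "post_var v = (\<lambda>y. (\<integral>h. (h - post_mean v y)\<^sup>2 * normal_density h (sqrt v) y \<partial>\<pi>) / marg v y)"
    unfolding gauss_posterior_var_def by (simp add: integral_posterior)
  thus ?thesis by simp
qed

lemma post_var_nonneg: "0 \<le> post_var v y"
proof -
  have "0 \<le> marg v y * post_var v y" unfolding marg_mult_post_var
    by (intro Bochner_Integration.integral_nonneg) auto
  thus ?thesis using marg_pos[of y] by (simp add: zero_le_mult_iff)
qed

lemma post_var_le: "post_var v y \<le> 4 * H\<^sup>2"
proof -
  have "marg v y * post_var v y \<le> (\<integral>h. 4 * H\<^sup>2 * normal_density h (sqrt v) y \<partial>\<pi>)"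
    unfolding marg_mult_post_var
    using sq_diff_le[OF abs_post_mean_le]
    by (intro integral_mono integrable_sq_density abs_post_mean_le integrable_mult_density[where B = "4 * H\<^sup>2"])
       (auto intro!: mult_right_mono)
  also have "\<dots> = marg v y * (4 * H\<^sup>2)" by (simp add: marg_def)
  finally show ?thesis using marg_pos[of y] by simp
qed

text \<open>Bias-variance decomposition: the second moment about \<open>c\<close> exceeds the one
  about the posterior mean by \<open>(post_mean v y - c)\<^sup>2 * marg v y\<close>.\<close>

lemma marg_mult_post_var_le:
  assumes c: "\<bar>c\<bar> \<le> H"
  shows "marg v y * post_var v y \<le> (\<integral>h. (h - c)\<^sup>2 * normal_density h (sqrt v) y \<partial>\<pi>)"
proof -
  let ?q = "\<lambda>h. normal_density h (sqrt v) y" and ?m = "post_mean v y"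
  have i: "integrable \<pi> (\<lambda>h. h * ?q h)" by (rule integrable_mult_density[where B = H]) auto
  have "(\<integral>h. (h - c)\<^sup>2 * ?q h \<partial>\<pi>) =
    (\<integral>h. (h - ?m)\<^sup>2 * ?q h + (2 * (?m - c) * (h * ?q h) + ((?m - c)\<^sup>2 - 2 * (?m - c) * ?m) * ?q h) \<partial>\<pi>)"
    by (intro Bochner_Integration.integral_cong) (auto simp: algebra_simps power2_eq_square)
  also have "\<dots> = marg v y * post_var v y
    + (2 * (?m - c) * (marg v y * ?m) + ((?m - c)\<^sup>2 - 2 * (?m - c) * ?m) * marg v y)"
    unfolding marg_mult_post_var marg_mult_post_mean
    using i integrable_density integrable_sq_density[OF abs_post_mean_le, of y y]
    by (simp add: marg_def)
  also have "\<dots> = marg v y * post_var v y + (?m - c)\<^sup>2 * marg v y"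
    by (simp add: algebra_simps)
  finally show ?thesis using marg_pos[of y] by simp
qed

end

section \<open>Stability of marginals and posterior variances in the noise level\<close>

text \<open>A common modulus: it dominates the change of \<open>marg\<close> and, up to powers of
  \<open>H\<close>, that of \<open>marg\<close> times the posterior variance or its square, while
  its integral over \<open>y\<close> is Lipschitz in the noise level.\<close>

definition marg_dist :: "real \<Rightarrow> real \<Rightarrow> real \<Rightarrow> real" where
  "marg_dist v v' y = (\<integral>h. \<bar>normal_density h (sqrt v) y - normal_density h (sqrt v') y\<bar> \<partial>\<pi>)"

lemma marg_dist_commute: "marg_dist v v' y = marg_dist v' v y"
  by (simp add: marg_dist_def abs_minus_commute)

lemma marg_dist_nonneg: "0 \<le> marg_dist v v' y"
  by (simp add: marg_dist_def)

text \<open>The factor \<open>f\<close> is held fixed while only the likelihood changes. One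
  direction is enough, because \<open>marg_dist\<close> is symmetric in the two noise
  levels.\<close>

lemma integral_density_le_marg_dist:
  assumes v: "0 < v" "0 < v'"
    and [measurable]: "f \<in> borel_measurable \<pi>" and f: "\<And>h. h \<in> {-H..H} \<Longrightarrow> \<bar>f h\<bar> \<le> B"
  shows "(\<integral>h. f h * normal_density h (sqrt v) y \<partial>\<pi>)
    \<le> (\<integral>h. f h * normal_density h (sqrt v') y \<partial>\<pi>) + B * marg_dist v v' y"
proof -
  let ?q = "\<lambda>v h. normal_density h (sqrt v) y"
  have i: "integrable \<pi> (\<lambda>h. f h * ?q v h)" "integrable \<pi> (\<lambda>h. f h * ?q v' h)"
    using f by (auto intro!: integrable_mult_density[where B = B] v)
  have i': "integrable \<pi> (\<lambda>h. \<bar>?q v h - ?q v' h\<bar>)"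
    using v by (intro integrable_abs Bochner_Integration.integrable_diff integrable_density)
  have "(\<integral>h. f h * ?q v h \<partial>\<pi>) \<le> (\<integral>h. f h * ?q v' h + B * \<bar>?q v h - ?q v' h\<bar> \<partial>\<pi>)"
  proof (rule integral_mono)
    fix h assume "h \<in> space \<pi>"
    hence "\<bar>f h * (?q v h - ?q v' h)\<bar> \<le> B * \<bar>?q v h - ?q v' h\<bar>"
      unfolding abs_mult using f by (intro mult_right_mono) auto
    thus "f h * ?q v h \<le> f h * ?q v' h + B * \<bar>?q v h - ?q v' h\<bar>"
      by (auto simp: algebra_simps)
  qed (use i i' in auto)
  thus ?thesis using i i' by (simp add: marg_dist_def)
qed

lemma abs_marg_diff_le:
  assumes "0 < v" "0 < v'"
  shows "\<bar>marg v y - marg v' y\<bar> \<le> marg_dist v v' y"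
  using integral_density_le_marg_dist[of v v' "\<lambda>_. 1" 1 y]
    integral_density_le_marg_dist[of v' v "\<lambda>_. 1" 1 y] assms marg_dist_commute[of v v' y]
  by (auto simp: marg_def abs_le_iff)

text \<open>Replacing the posterior mean by that of the other noise level only increases the variance.\<close>

lemma abs_marg_mult_post_var_diff_le:
  assumes v: "0 < v" "0 < v'"
  shows "\<bar>marg v y * post_var v y - marg v' y * post_var v' y\<bar> \<le> 4 * H\<^sup>2 * marg_dist v v' y"
proof -
  have *: "marg v y * post_var v y \<le> marg v' y * post_var v' y + 4 * H\<^sup>2 * marg_dist v v' y"
    if "0 < v" "0 < v'" for v v'
  proof -
    have m: "\<bar>post_mean v' y\<bar> \<le> H" using that by (intro abs_post_mean_le)
    have "marg v y * post_var v y \<le> (\<integral>h. (h - post_mean v' y)\<^sup>2 * normal_density h (sqrt v) y \<partial>\<pi>)"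
      using that m by (intro marg_mult_post_var_le)
    also have "\<dots> \<le> (\<integral>h. (h - post_mean v' y)\<^sup>2 * normal_density h (sqrt v') y \<partial>\<pi>)
        + 4 * H\<^sup>2 * marg_dist v v' y"
      using that sq_diff_le[OF _ m] m by (intro integral_density_le_marg_dist) (auto simp: sq_diff_le)
    finally show ?thesis using that by (simp add: marg_mult_post_var)
  qed
  show ?thesis using *[of v v'] *[of v' v] v marg_dist_commute[of v v' y] by (auto simp: abs_le_iff)
qed

lemma abs_marg_mult_post_var_sq_diff_le:
  assumes v: "0 < v" "0 < v'"
  shows "\<bar>marg v y * (post_var v y)\<^sup>2 - marg v' y * (post_var v' y)\<^sup>2\<bar> \<le> 48 * H ^ 4 * marg_dist v v' y"
proof -
  define W where "W = 4 * H\<^sup>2"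
  define p p' w w' d where defs: "p = marg v y" "p' = marg v' y" "w = post_var v y" "w' = post_var v' y"
    "d = marg_dist v v' y"
  have w: "\<bar>w\<bar> \<le> W" "\<bar>w'\<bar> \<le> W"
    using v post_var_nonneg[of v y] post_var_le[of v y] post_var_nonneg[of v' y] post_var_le[of v' y]
    by (auto simp: defs W_def)
  have W: "0 \<le> W" and d: "0 \<le> d" by (auto simp: W_def defs marg_dist_nonneg)
  have A: "\<bar>p * w - p' * w'\<bar> \<le> W * d" and B: "\<bar>p' - p\<bar> \<le> d"
    using abs_marg_mult_post_var_diff_le[OF v, of y] abs_marg_diff_le[OF v, of y]
    by (auto simp: defs W_def)
  \<comment> \<open>This telescoping involves only the differences of \<open>p\<close> and of
    \<open>p * w\<close>, which are under control, and never \<open>w - w'\<close>. Each of the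
    three terms is at most \<open>W\<^sup>2 * d\<close>, whence 3 * 16 = 48.\<close>
  have "p * w\<^sup>2 - p' * w'\<^sup>2 = (p * w - p' * w') * w + w' * (p' - p) * w + w' * (p * w - p' * w')"
    by (simp add: algebra_simps power2_eq_square)
  also have "\<bar>\<dots>\<bar> \<le> \<bar>p * w - p' * w'\<bar> * \<bar>w\<bar> + \<bar>w'\<bar> * \<bar>p' - p\<bar> * \<bar>w\<bar> + \<bar>w'\<bar> * \<bar>p * w - p' * w'\<bar>"
    unfolding abs_mult[symmetric] by linarith
  also have "\<dots> \<le> (W * d) * W + W * d * W + W * (W * d)"
    using w W A B d by (intro add_mono mult_mono) auto
  also have "\<dots> = 48 * H ^ 4 * d"
    by (simp add: W_def power2_eq_square power4_eq_xxxx)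
  finally show ?thesis by (simp add: defs)
qed

section \<open>Exchanging the integrals over parameter and observation\<close>

lemma integrable_pair_density:
  fixes f :: "real \<Rightarrow> real"
  assumes v: "0 < v" and [measurable]: "f \<in> borel_measurable borel" and f: "\<And>y. \<bar>f y\<bar> \<le> B"
  shows "integrable (\<pi> \<Otimes>\<^sub>M lborel) (\<lambda>(h, y). normal_density h (sqrt v) y * f y)"
proof -
  have q: "integrable lborel (\<lambda>y. normal_density h (sqrt v) y * f y)" for h
  proof (rule Bochner_Integration.integrable_bound)
    show "integrable lborel (\<lambda>y. B * normal_density h (sqrt v) y)" using v by auto
    show "AE y in lborel. norm (normal_density h (sqrt v) y * f y) \<le> norm (B * normal_density h (sqrt v) y)"
      using f abs_ge_zero[THEN order_trans, OF f]
      by (auto simp: abs_mult mult.commute[of B] intro!: mult_left_mono)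
    show "(\<lambda>y. normal_density h (sqrt v) y * f y) \<in> borel_measurable lborel"
      using assms(2) by (intro borel_measurable_times) simp_all
  qed
  have "\<bar>\<integral>y. norm (normal_density h (sqrt v) y * f y) \<partial>lborel\<bar> \<le> B" for h
  proof -
    have "(\<integral>y. norm (normal_density h (sqrt v) y * f y) \<partial>lborel)
        \<le> (\<integral>y. B * normal_density h (sqrt v) y \<partial>lborel)"
      using f v by (intro integral_mono integrable_norm q)
        (auto simp: abs_mult mult.commute[of B] intro!: mult_left_mono)
    thus ?thesis using v by simp
  qed
  hence "integrable \<pi> (\<lambda>h. \<integral>y. norm (normal_density h (sqrt v) y * f y) \<partial>lborel)"
    by (intro integrable_prior[where B = B]) measurable
  thus ?thesis using q by (intro Fubini_integrable) auto
qed

lemma integrable_marg_mult: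
  fixes f :: "real \<Rightarrow> real"
  assumes "0 < v" "f \<in> borel_measurable borel" "\<And>y. \<bar>f y\<bar> \<le> B"
  shows "integrable lborel (\<lambda>y. marg v y * f y)"
  using integrable_snd[OF integrable_pair_density[OF assms]] by (simp add: marg_def)

lemma gauss_expectation_eq:
  fixes f :: "real \<Rightarrow> real"
  assumes "0 < v" and [measurable]: "f \<in> borel_measurable borel" and "\<And>y. \<bar>f y\<bar> \<le> B"
  shows "gauss_expectation v \<pi> f = (\<integral>y. marg v y * f y \<partial>lborel)"
proof -
  have "gauss_expectation v \<pi> f = (\<integral>h. (\<integral>y. normal_density h (sqrt v) y * f y \<partial>lborel) \<partial>\<pi>)"
    unfolding gauss_expectation_def gauss_law_def
    by (rule Bochner_Integration.integral_cong[OF refl]) (simp add: integral_density)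
  also have "\<dots> = (\<integral>y. (\<integral>h. normal_density h (sqrt v) y * f y \<partial>\<pi>) \<partial>lborel)"
    using Fubini_integral[OF integrable_pair_density[OF assms]] by simp
  finally show ?thesis by (simp add: marg_def)
qed

lemma integral_marg: "0 < v \<Longrightarrow> (\<integral>y. marg v y \<partial>lborel) = 1"
  using gauss_expectation_eq[of v "\<lambda>_. 1" 1] prob_space_normal_density[of "sqrt v", THEN prob_space.prob_space]
  by (simp add: gauss_expectation_def gauss_law_def)

lemma integrable_marg: "0 < v \<Longrightarrow> integrable lborel (marg v)"
  using integrable_marg_mult[of v "\<lambda>_. 1" 1] by simp

lemma marg_dist_integral_le:
  assumes a: "0 < a" "v \<in> {a..b}" "v' \<in> {a..b}"
  shows "integrable lborel (marg_dist v v')"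
    and "(\<integral>y. marg_dist v v' y \<partial>lborel) \<le> (1 / a + b / a\<^sup>2) * \<bar>v - v'\<bar>"
proof -
  have pos: "0 < v" "0 < v'" using a by auto
  let ?d = "\<lambda>h y. \<bar>normal_density h (sqrt v) y - normal_density h (sqrt v') y\<bar>"
  have I: "integrable (\<pi> \<Otimes>\<^sub>M lborel) (\<lambda>(h, y). ?d h y)"
    using integrable_abs[OF Bochner_Integration.integrable_diff[OF
      integrable_pair_density[OF pos(1), of "\<lambda>_. 1" 1] integrable_pair_density[OF pos(2), of "\<lambda>_. 1" 1]]]
    by (simp add: case_prod_unfold)
  show "integrable lborel (marg_dist v v')"
    using integrable_snd[OF I] by (simp add: marg_dist_def[abs_def])
  have "(\<integral>y. marg_dist v v' y \<partial>lborel) = (\<integral>h. (\<integral>y. ?d h y \<partial>lborel) \<partial>\<pi>)"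
    unfolding marg_dist_def by (rule Fubini_integral[OF I])
  also have "\<dots> \<le> (\<integral>h. (1 / a + b / a\<^sup>2) * \<bar>v - v'\<bar> \<partial>\<pi>)"
    using integrable_fst[OF I] normal_density_L1_dist_le[OF a] by (intro integral_mono) auto
  finally show "(\<integral>y. marg_dist v v' y \<partial>lborel) \<le> (1 / a + b / a\<^sup>2) * \<bar>v - v'\<bar>"
    by simp
qed

lemma abs_post_var_power_le: "0 < v \<Longrightarrow> \<bar>post_var v y ^ k\<bar> \<le> (4 * H\<^sup>2) ^ k"
  using post_var_nonneg[of v y] post_var_le[of v y] power_mono[of "post_var v y" "4 * H\<^sup>2" k]
  by simp

section \<open>The expected squared relative posterior variance\<close>

text \<open>The function g of the overview for the prior \<open>\<pi>\<close>: the transfer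
  assumption compares the derivative of the Bayes risk with it.\<close>

definition sq_var :: "real \<Rightarrow> real" where
  "sq_var v = gauss_expectation v \<pi> (\<lambda>y. (post_var v y / v)\<^sup>2)"

lemma sq_var_eq:
  assumes "0 < v"
  shows "sq_var v = (\<integral>y. marg v y * (post_var v y)\<^sup>2 \<partial>lborel) / v\<^sup>2"
proof -
  have "sq_var v = (\<integral>y. marg v y * (post_var v y / v)\<^sup>2 \<partial>lborel)"
    unfolding sq_var_def using assms abs_post_var_power_le[OF assms, of _ 2]
    by (intro gauss_expectation_eq[where B = "(4 * H\<^sup>2)\<^sup>2 / v\<^sup>2"])
       (auto simp: power_divide intro!: divide_right_mono)
  thus ?thesis by (simp add: power_divide)
qed

text \<open>Product rule for \<open>G v / v\<^sup>2\<close>: the numerator is Lipschitz by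
  integrating the pointwise bound and is at most \<open>16 * H ^ 4\<close>, as the posterior
  variance is at most \<open>4 * H\<^sup>2\<close>; the reciprocal square has Lipschitz constant
  \<open>2 * b / a ^ 4\<close> on the interval.\<close>

lemma sq_var_lipschitz:
  assumes a: "0 < a" "v \<in> {a..b}" "v' \<in> {a..b}"
  shows "\<bar>sq_var v - sq_var v'\<bar>
    \<le> (48 * (1 / a + b / a\<^sup>2) / a\<^sup>2 + 32 * b / a ^ 4) * H ^ 4 * \<bar>v - v'\<bar>"
proof -
  have pos: "0 < v" "0 < v'" using a by auto
  define G where "G = (\<lambda>v. \<integral>y. marg v y * (post_var v y)\<^sup>2 \<partial>lborel)"
  define L where "L = 1 / a + b / a\<^sup>2"
  have L_nonneg: "0 \<le> L" using a by (auto simp: L_def)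
  have int: "integrable lborel (\<lambda>y. marg u y * (post_var u y)\<^sup>2)" if "0 < u" for u
    using that abs_post_var_power_le[OF that, of _ 2] by (intro integrable_marg_mult) auto
  have "\<bar>G v - G v'\<bar> = \<bar>\<integral>y. marg v y * (post_var v y)\<^sup>2 - marg v' y * (post_var v' y)\<^sup>2 \<partial>lborel\<bar>"
    unfolding G_def by (subst Bochner_Integration.integral_diff) (use int pos in auto)
  also have "\<dots> \<le> (\<integral>y. \<bar>marg v y * (post_var v y)\<^sup>2 - marg v' y * (post_var v' y)\<^sup>2\<bar> \<partial>lborel)"
    by (rule integral_abs_bound)
  also have "\<dots> \<le> (\<integral>y. 48 * H ^ 4 * marg_dist v v' y \<partial>lborel)"
    using int pos marg_dist_integral_le(1)[OF a] abs_marg_mult_post_var_sq_diff_le[OF pos]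
    by (intro integral_mono) auto
  also have "\<dots> \<le> 48 * H ^ 4 * (L * \<bar>v - v'\<bar>)"
    using marg_dist_integral_le(2)[OF a] by (auto simp: L_def intro!: mult_left_mono)
  finally have G: "\<bar>G v - G v'\<bar> \<le> 48 * H ^ 4 * (L * \<bar>v - v'\<bar>)" .
  have G': "\<bar>G v'\<bar> \<le> 16 * H ^ 4"
  proof -
    have "\<bar>G v'\<bar> \<le> (\<integral>y. \<bar>marg v' y * (post_var v' y)\<^sup>2\<bar> \<partial>lborel)"
      unfolding G_def by (rule integral_abs_bound)
    also have "\<dots> \<le> (\<integral>y. marg v' y * (4 * H\<^sup>2)\<^sup>2 \<partial>lborel)"
      using int[OF pos(2)] integrable_marg[OF pos(2)] marg_pos[OF pos(2)]
        abs_post_var_power_le[OF pos(2), of _ 2]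
      by (intro integral_mono integrable_abs) (auto simp: abs_mult abs_of_pos intro!: mult_left_mono less_imp_le)
    also have "\<dots> = 16 * H ^ 4" using integral_marg[OF pos(2)] by (simp add: power_mult_distrib)
    finally show ?thesis .
  qed
  have "sq_var v - sq_var v' = (G v - G v') / v\<^sup>2 + G v' * (1 / v\<^sup>2 - 1 / v'\<^sup>2)"
    using pos by (simp add: sq_var_eq G_def field_simps)
  also have "\<bar>\<dots>\<bar> \<le> \<bar>G v - G v'\<bar> * (1 / v\<^sup>2) + \<bar>G v'\<bar> * \<bar>1 / v\<^sup>2 - 1 / v'\<^sup>2\<bar>"
    using abs_triangle_ineq[of "(G v - G v') / v\<^sup>2" "G v' * (1 / v\<^sup>2 - 1 / v'\<^sup>2)"]
    unfolding abs_mult by simp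
  also have "\<bar>1 / v\<^sup>2 - 1 / v'\<^sup>2\<bar> \<le> \<bar>v - v'\<bar> * (2 * b / a ^ 4)"
  proof -
    have "1 / v\<^sup>2 - 1 / v'\<^sup>2 = (v' - v) * ((v + v') / (v\<^sup>2 * v'\<^sup>2))"
      using pos by (simp add: field_simps power2_eq_square)
    also have "\<bar>\<dots>\<bar> = \<bar>v - v'\<bar> * ((v + v') / (v\<^sup>2 * v'\<^sup>2))"
      using pos by (simp add: abs_mult abs_minus_commute)
    also have "\<dots> \<le> \<bar>v - v'\<bar> * ((b + b) / (a\<^sup>2 * a\<^sup>2))"
      using a by (intro mult_left_mono frac_le mult_mono power_mono add_mono) auto
    finally show ?thesis by (simp flip: power_add)
  qed
  also have "\<bar>G v - G v'\<bar> * (1 / v\<^sup>2) + \<bar>G v'\<bar> * (\<bar>v - v'\<bar> * (2 * b / a ^ 4)) \<le>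
     48 * H ^ 4 * (L * \<bar>v - v'\<bar>) * (1 / a\<^sup>2) + 16 * H ^ 4 * (\<bar>v - v'\<bar> * (2 * b / a ^ 4))"
    using G G' a by (intro add_mono mult_mono) (auto intro!: divide_left_mono power_mono simp: L_nonneg)
  also have "\<dots> = (48 * L / a\<^sup>2 + 32 * b / a ^ 4) * H ^ 4 * \<bar>v - v'\<bar>"
    by (simp add: algebra_simps)
  finally show ?thesis by (simp add: L_def mult_left_mono)
qed

end

section \<open>Gaussian Bayes risks\<close>

lemma sq_risk_gauss_law:
  assumes "0 < v" and [measurable]: "d \<in> borel_measurable borel"
  shows "sq_risk (gauss_law v) d h =
    (\<integral>\<^sup>+ y. ennreal (normal_density h (sqrt v) y * (d y - h)\<^sup>2) \<partial>lborel)"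
  unfolding sq_risk_def gauss_law_def
  by (subst nn_integral_density) (auto simp: ennreal_mult')

lemma measurable_sq_risk_gauss_law [measurable]:
  assumes "0 < v" and [measurable]: "d \<in> borel_measurable borel"
  shows "sq_risk (gauss_law v) d \<in> borel_measurable borel"
  unfolding sq_risk_gauss_law[OF assms, abs_def] by measurable

lemma sq_risk_gauss_law_ident:
  assumes "0 < v"
  shows "sq_risk (gauss_law v) (\<lambda>y. y) h = ennreal v"
  using normal_density_second_moment[OF assms, of h] assms
  by (simp add: sq_risk_gauss_law nn_integral_eq_integral has_bochner_integral_iff)

text \<open>Moves an error term across an inequality whose other side may be infinite. A negative
  \<open>B - k\<close> is harmless: \<open>ennreal\<close> maps it to 0, and both sides then
  hold.\<close>

lemma ennreal_diff_le_iff: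
  assumes "0 \<le> k"
  shows "ennreal (B - k) \<le> X \<longleftrightarrow> ennreal B \<le> X + ennreal k"
  by (cases X) (use assms in \<open>auto simp flip: ennreal_plus simp: ennreal_le_iff2\<close>)

lemma normal_density_sq_dist_ge:
  assumes "0 < v"
  shows "ennreal v \<le> (\<integral>\<^sup>+ h. ennreal (normal_density m (sqrt v) h * (c - h)\<^sup>2) \<partial>lborel)"
proof -
  let ?q = "normal_density m (sqrt v)"
  \<comment> \<open>Expands \<open>(c - h)\<^sup>2\<close> around the mean \<open>m\<close>; the
    exponent \<open>2 * 0 + 1\<close> has the form of the odd-moment rule, which makes the cross
    term vanish.\<close>
  have "has_bochner_integral lborel
      (\<lambda>h. ?q h * (h - m)\<^sup>2 + (2 * (m - c) * (?q h * (h - m) ^ (2 * 0 + 1)) + (m - c)\<^sup>2 * ?q h))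
      (v + (2 * (m - c) * 0 + (m - c)\<^sup>2 * 1))"
    using assms normal_moment_odd[of "sqrt v" m 0] integral_normal_density[of "sqrt v" m]
      integrable_normal_density[of "sqrt v" m]
    by (intro has_bochner_integral_add has_bochner_integral_mult_right normal_density_second_moment)
       (auto simp: has_bochner_integral_iff)
  moreover have "?q h * (h - m)\<^sup>2 + (2 * (m - c) * (?q h * (h - m) ^ (2 * 0 + 1)) + (m - c)\<^sup>2 * ?q h)
      = ?q h * (c - h)\<^sup>2" for h
    by (simp add: algebra_simps power2_eq_square)
  ultimately have "has_bochner_integral lborel (\<lambda>h. ?q h * (c - h)\<^sup>2) (v + (m - c)\<^sup>2)"
    by simp
  hence "(\<integral>\<^sup>+ h. ennreal (?q h * (c - h)\<^sup>2) \<partial>lborel) = ennreal (v + (m - c)\<^sup>2)"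
    by (simp add: nn_integral_eq_integral has_bochner_integral_iff)
  thus ?thesis by (simp add: ennreal_leI)
qed

text \<open>After exchanging the integrals, conjugacy turns the inner one into a mean squared
  distance under the posterior of \<open>h\<close> given \<open>y\<close>. It is at least the
  posterior variance, which does not depend on \<open>y\<close>.\<close>

lemma gaussian_prior_risk_ge:
  assumes s: "0 < s" and v: "0 < v" and d[measurable]: "d \<in> borel_measurable borel"
  shows "ennreal (s * v / (s + v))
    \<le> (\<integral>\<^sup>+ h. ennreal (normal_density 0 (sqrt s) h) * sq_risk (gauss_law v) d h \<partial>lborel)"
proof -
  define \<sigma> where "\<sigma> = s * v / (s + v)"
  have \<sigma>: "0 < \<sigma>" using s v by (simp add: \<sigma>_def)
  let ?p = "normal_density 0 (sqrt (s + v))"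
  have "(\<integral>\<^sup>+ h. ennreal (normal_density 0 (sqrt s) h) * sq_risk (gauss_law v) d h \<partial>lborel) =
    (\<integral>\<^sup>+ h. (\<integral>\<^sup>+ y. ennreal (normal_density 0 (sqrt s) h * normal_density h (sqrt v) y * (d y - h)\<^sup>2)
       \<partial>lborel) \<partial>lborel)"
    unfolding sq_risk_gauss_law[OF v d]
    by (intro nn_integral_cong, subst nn_integral_cmult[symmetric])
       (auto simp: ennreal_mult'[symmetric] mult.assoc)
  also have "\<dots> = (\<integral>\<^sup>+ y. (\<integral>\<^sup>+ h. ennreal (normal_density 0 (sqrt s) h * normal_density h (sqrt v) y * (d y - h)\<^sup>2)
       \<partial>lborel) \<partial>lborel)"
    by (rule lborel_pair.Fubini'[symmetric]) measurable
  also have "\<dots> = (\<integral>\<^sup>+ y. ennreal (?p y) * (\<integral>\<^sup>+ h. ennreal (normal_density (s * y / (s + v)) (sqrt \<sigma>) h * (d y - h)\<^sup>2)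
       \<partial>lborel) \<partial>lborel)"
    unfolding normal_density_mult[OF s v] \<sigma>_def
    by (intro nn_integral_cong, subst nn_integral_cmult[symmetric])
       (auto simp: ennreal_mult'[symmetric] mult.assoc)
  also have "\<dots> \<ge> (\<integral>\<^sup>+ y. ennreal (?p y) * ennreal \<sigma> \<partial>lborel)"
    by (intro nn_integral_mono mult_left_mono normal_density_sq_dist_ge \<sigma>) auto
  also have "(\<integral>\<^sup>+ y. ennreal (?p y) * ennreal \<sigma> \<partial>lborel) = ennreal \<sigma>"
    using s v by (subst nn_integral_multc) (auto simp: nn_integral_eq_integral)
  finally show ?thesis by (simp add: \<sigma>_def)
qed

section \<open>Bounds for the Gaussian Bayes risk of a bounded prior\<close>

context gauss_prior
begin

text \<open>The estimator returning the observation has risk \<open>v\<close> at every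
  \<open>h\<close>. Besides the bound itself, this gives the finiteness that makes
  \<open>enn2real\<close> lossless.\<close>

lemma gauss_bayes_INF_le:
  assumes "0 < v"
  shows "(INF d \<in> borel_measurable borel. \<integral>\<^sup>+ h. sq_risk (gauss_law v) d h \<partial>\<pi>) \<le> ennreal v"
proof -
  have "(INF d \<in> borel_measurable borel. \<integral>\<^sup>+ h. sq_risk (gauss_law v) d h \<partial>\<pi>)
      \<le> (\<integral>\<^sup>+ h. sq_risk (gauss_law v) (\<lambda>y. y) h \<partial>\<pi>)"
    by (rule INF_lower) simp
  thus ?thesis using assms emeasure_space_1 by (simp add: sq_risk_gauss_law_ident)
qed

lemma ennreal_gauss_bayes_risk:
  assumes "0 < v"
  shows "ennreal (gauss_bayes_risk v \<pi>) =
    (INF d \<in> borel_measurable borel. \<integral>\<^sup>+ h. sq_risk (gauss_law v) d h \<partial>\<pi>)"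
  unfolding gauss_bayes_risk_def bayes_risk_def
  by (intro ennreal_enn2real le_less_trans[OF gauss_bayes_INF_le[OF assms]] ennreal_less_top)

lemma gauss_bayes_risk_nonneg: "0 \<le> gauss_bayes_risk v \<pi>"
  by (simp add: gauss_bayes_risk_def bayes_risk_def)

lemma gauss_bayes_risk_le: "0 < v \<Longrightarrow> gauss_bayes_risk v \<pi> \<le> v"
  using gauss_bayes_INF_le[of v] by (simp flip: ennreal_gauss_bayes_risk)

lemma gauss_bayes_risk_le_estimator:
  assumes "0 < v" "d \<in> borel_measurable borel"
  shows "ennreal (gauss_bayes_risk v \<pi>) \<le> (\<integral>\<^sup>+ h. sq_risk (gauss_law v) d h \<partial>\<pi>)"
  unfolding ennreal_gauss_bayes_risk[OF assms(1)] by (rule INF_lower) fact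

lemma gauss_bayes_risk_ge:
  assumes "0 < v"
    and "\<And>d. d \<in> borel_measurable borel \<Longrightarrow> ennreal B \<le> (\<integral>\<^sup>+ h. sq_risk (gauss_law v) d h \<partial>\<pi>)"
  shows "B \<le> gauss_bayes_risk v \<pi>"
proof -
  have "ennreal B \<le> ennreal (gauss_bayes_risk v \<pi>)"
    unfolding ennreal_gauss_bayes_risk[OF assms(1)] by (rule INF_greatest) (fact assms(2))
  thus ?thesis using gauss_bayes_risk_nonneg[of v] by (simp add: ennreal_le_iff)
qed

text \<open>The posterior mean is used as the estimator; by Tonelli its Bayes risk is the marginal
  average of the posterior variance.\<close>

lemma gauss_bayes_risk_le_post_var:
  assumes v: "0 < v"
  shows "gauss_bayes_risk v \<pi> \<le> (\<integral>y. marg v y * post_var v y \<partial>lborel)"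
proof -
  note [measurable] = measurable_post_mean[OF v]
  have i: "integrable lborel (\<lambda>y. marg v y * post_var v y)"
    using v abs_post_var_power_le[OF v, of _ 1] by (intro integrable_marg_mult) auto
  have "ennreal (gauss_bayes_risk v \<pi>) \<le> (\<integral>\<^sup>+ h. sq_risk (gauss_law v) (post_mean v) h \<partial>\<pi>)"
    by (intro gauss_bayes_risk_le_estimator v) measurable
  also have "\<dots> = (\<integral>\<^sup>+ h. (\<integral>\<^sup>+ y. ennreal ((h - post_mean v y)\<^sup>2 * normal_density h (sqrt v) y) \<partial>lborel) \<partial>\<pi>)"
    using v by (simp add: sq_risk_gauss_law mult.commute power2_commute)
  also have "\<dots> = (\<integral>\<^sup>+ y. (\<integral>\<^sup>+ h. ennreal ((h - post_mean v y)\<^sup>2 * normal_density h (sqrt v) y) \<partial>\<pi>) \<partial>lborel)"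
    by (rule Fubini'[symmetric]) measurable
  also have "\<dots> = (\<integral>\<^sup>+ y. ennreal (marg v y * post_var v y) \<partial>lborel)"
    unfolding marg_mult_post_var[OF v]
    by (intro nn_integral_cong nn_integral_eq_integral integrable_sq_density abs_post_mean_le v) auto
  also have "\<dots> = ennreal (\<integral>y. marg v y * post_var v y \<partial>lborel)"
    using less_imp_le[OF marg_pos[OF v]] post_var_nonneg[OF v]
    by (intro nn_integral_eq_integral i) auto
  finally show ?thesis
    using less_imp_le[OF marg_pos[OF v]] post_var_nonneg[OF v]
    by (subst (asm) ennreal_le_iff) (auto intro!: Bochner_Integration.integral_nonneg)
qed

text \<open>With w the posterior variance, \<open>(w - v)\<^sup>2 \<ge> 0\<close> gives
  \<open>w\<^sup>2 \<ge> 2 * v * w - v\<^sup>2\<close>. This is averaged over the marginal, which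
  has mass one, and the average of w is at least the Bayes risk.\<close>

lemma sq_var_ge:
  assumes v: "0 < v"
  shows "2 * gauss_bayes_risk v \<pi> / v - 1 \<le> sq_var v"
proof -
  have i: "integrable lborel (\<lambda>y. marg v y * post_var v y)"
    using v abs_post_var_power_le[OF v, of _ 1] by (intro integrable_marg_mult) auto
  have i2: "integrable lborel (\<lambda>y. marg v y * (post_var v y)\<^sup>2)"
    using v abs_post_var_power_le[OF v, of _ 2] by (intro integrable_marg_mult) auto
  have "2 * v * gauss_bayes_risk v \<pi> - v\<^sup>2 \<le> 2 * v * (\<integral>y. marg v y * post_var v y \<partial>lborel) - v\<^sup>2"
    using gauss_bayes_risk_le_post_var[OF v] v by simp
  also have "\<dots> = (\<integral>y. 2 * v * (marg v y * post_var v y) - v\<^sup>2 * marg v y \<partial>lborel)"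
    using i integrable_marg[OF v] integral_marg[OF v] by simp
  also have "\<dots> \<le> (\<integral>y. marg v y * (post_var v y)\<^sup>2 \<partial>lborel)"
  proof (rule integral_mono)
    fix y
    have "marg v y * (2 * v * post_var v y - v\<^sup>2) \<le> marg v y * (post_var v y)\<^sup>2"
      using marg_pos[OF v, of y] sum_squares_bound[of v "post_var v y"]
      by (intro mult_left_mono) auto
    thus "2 * v * (marg v y * post_var v y) - v\<^sup>2 * marg v y \<le> marg v y * (post_var v y)\<^sup>2"
      by (simp add: algebra_simps)
  qed (use i i2 integrable_marg[OF v] in auto)
  also have "\<dots> = sq_var v * v\<^sup>2" using v by (simp add: sq_var_eq)
  finally have "(2 * v * gauss_bayes_risk v \<pi> - v\<^sup>2) / v\<^sup>2 \<le> sq_var v"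
    using v by (simp add: divide_le_eq)
  thus ?thesis using v by (simp add: diff_divide_distrib power2_eq_square)
qed

text \<open>Multiplying parameter and observation by \<open>sqrt (v / v')\<close> turns noise level \<open>v'\<close> into \<open>v\<close>.\<close>

lemma ex_scaled_prior:
  assumes v: "0 < v" "v \<le> v'"
  shows "\<exists>\<pi>'\<in>priors H. gauss_bayes_risk v' \<pi> \<le> v' / v * gauss_bayes_risk v \<pi>'"
proof -
  define s where "s = sqrt (v / v')"
  have s: "0 < s" "s \<le> 1" "s\<^sup>2 = v / v'" using v by (auto simp: s_def)
  have sv: "sqrt v = s * sqrt v'" using v by (simp add: s_def real_sqrt_divide)
  \<comment> \<open>Since \<open>s \<le> 1\<close>, scaling shrinks the parameter, so the new prior
    stays on the same interval.\<close>
  have mult_s: "s * h \<in> {-H..H}" if "h \<in> {-H..H}" for h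
  proof -
    have "\<bar>s * h\<bar> \<le> 1 * H" unfolding abs_mult using that s by (intro mult_mono) auto
    thus ?thesis by auto
  qed
  have [measurable]: "(\<lambda>h. s * h) \<in> \<pi> \<rightarrow>\<^sub>M restrict_space borel {-H..H}"
    using mult_s by (intro measurable_restrict_space2) auto
  define \<pi>' where "\<pi>' = distr \<pi> (restrict_space borel {-H..H}) (\<lambda>h. s * h)"
  have prior': "\<pi>' \<in> priors H"
    unfolding priors_def \<pi>'_def space_prob_algebra by (auto intro!: prob_space_distr)
  interpret P': gauss_prior \<pi>' H by unfold_locales (fact prior')
  have "s\<^sup>2 * gauss_bayes_risk v' \<pi> \<le> gauss_bayes_risk v \<pi>'"
  proof (rule P'.gauss_bayes_risk_ge[OF v(1)])
    fix d :: "real \<Rightarrow> real" assume d[measurable]: "d \<in> borel_measurable borel"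
    \<comment> \<open>The estimator for noise level \<open>v'\<close> that scales the observation by
      \<open>s\<close>, applies \<open>d\<close>, and scales the answer back; every squared error
      changes by the factor \<open>s\<^sup>2\<close>.\<close>
    define d' where "d' y = d (s * y) / s" for y
    have d'[measurable]: "d' \<in> borel_measurable borel" unfolding d'_def[abs_def] by measurable
    have risk: "sq_risk (gauss_law v) d (s * h) = ennreal (s\<^sup>2) * sq_risk (gauss_law v') d' h" for h
    proof -
      have "sq_risk (gauss_law v) d (s * h) =
         ennreal s * (\<integral>\<^sup>+ y. ennreal (normal_density (s * h) (sqrt v) (0 + s * y) * (d (0 + s * y) - s * h)\<^sup>2) \<partial>lborel)"
        unfolding sq_risk_gauss_law[OF v(1) d]
        using s by (subst nn_integral_real_affine[where t = 0 and c = s]) auto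
      also have "\<dots> = (\<integral>\<^sup>+ y. ennreal (s * (normal_density (s * h) (sqrt v) (s * y) * (d (s * y) - s * h)\<^sup>2)) \<partial>lborel)"
        using s by (subst nn_integral_cmult[symmetric]) (auto simp: ennreal_mult')
      also have "\<dots> = (\<integral>\<^sup>+ y. ennreal (s\<^sup>2 * (normal_density h (sqrt v') y * (d' y - h)\<^sup>2)) \<partial>lborel)"
      proof (intro nn_integral_cong arg_cong[where f = ennreal])
        fix y
        have "s * normal_density (s * h) (sqrt v) (s * y) = normal_density h (sqrt v') y"
        proof -
          have "(s * y - s * h)\<^sup>2 / (2 * v) = (y - h)\<^sup>2 / (2 * v')"
          proof -
            have "(s * y - s * h)\<^sup>2 = s\<^sup>2 * (y - h)\<^sup>2" by (simp add: power_mult_distrib flip: right_diff_distrib)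
            thus ?thesis using v by (simp add: s(3))
          qed
          moreover have "s / sqrt (2 * pi * v) = 1 / sqrt (2 * pi * v')"
            using s v by (simp add: real_sqrt_mult sv)
          moreover have "s * normal_density (s * h) (sqrt v) (s * y) =
              s / sqrt (2 * pi * v) * exp (- ((s * y - s * h)\<^sup>2 / (2 * v)))"
            using v by (simp add: normal_density_def)
          ultimately show ?thesis using v by (simp add: normal_density_def del: times_divide_eq_left)
        qed
        moreover have "(d (s * y) - s * h)\<^sup>2 = s\<^sup>2 * (d' y - h)\<^sup>2"
        proof -
          have "d (s * y) - s * h = s * (d' y - h)" using s by (simp add: d'_def algebra_simps)
          thus ?thesis by (simp add: power_mult_distrib)
        qed
        ultimately show "s * (normal_density (s * h) (sqrt v) (s * y) * (d (s * y) - s * h)\<^sup>2) =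
          s\<^sup>2 * (normal_density h (sqrt v') y * (d' y - h)\<^sup>2)"
          by (simp add: mult.assoc[symmetric])
      qed
      also have "\<dots> = ennreal (s\<^sup>2) * sq_risk (gauss_law v') d' h"
        using v by (subst sq_risk_gauss_law) (auto simp: ennreal_mult' nn_integral_cmult)
      finally show ?thesis .
    qed
    have "ennreal (s\<^sup>2 * gauss_bayes_risk v' \<pi>) \<le> ennreal (s\<^sup>2) * (\<integral>\<^sup>+ h. sq_risk (gauss_law v') d' h \<partial>\<pi>)"
      using v by (subst ennreal_mult') (auto intro!: mult_left_mono gauss_bayes_risk_le_estimator)
    also have "\<dots> = (\<integral>\<^sup>+ h. ennreal (s\<^sup>2) * sq_risk (gauss_law v') d' h \<partial>\<pi>)"
      using v by (subst nn_integral_cmult) (auto intro!: measurable_prior measurable_sq_risk_gauss_law)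
    also have "\<dots> = (\<integral>\<^sup>+ h. sq_risk (gauss_law v) d (s * h) \<partial>\<pi>)"
      by (simp add: risk)
    also have "\<dots> = (\<integral>\<^sup>+ h. sq_risk (gauss_law v) d h \<partial>\<pi>')"
      unfolding \<pi>'_def
      using v by (subst nn_integral_distr) (auto intro!: measurable_restrict_space1 measurable_sq_risk_gauss_law)
    finally show "ennreal (s\<^sup>2 * gauss_bayes_risk v' \<pi>) \<le> (\<integral>\<^sup>+ h. sq_risk (gauss_law v) d h \<partial>\<pi>')" .
  qed
  hence "gauss_bayes_risk v' \<pi> \<le> v' / v * gauss_bayes_risk v \<pi>'"
    using v by (simp add: s(3) field_simps)
  with prior' show ?thesis by blast
qed

end

text \<open>The prior is \<open>N(0, s)\<close> conditioned on \<open>[-H, H]\<close>; \<open>12 * s\<^sup>2 / H\<^sup>2\<close> accounts for the tail.\<close>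

lemma ex_prior_risk_ge:
  assumes H: "0 < H" and s: "0 < s" and v: "0 < v"
  shows "\<exists>\<pi>\<in>priors H. s * v / (s + v) - 12 * s\<^sup>2 / H\<^sup>2 \<le> gauss_bayes_risk v \<pi>"
proof -
  define A where "A = {-H..H}"
  have [measurable]: "A \<in> sets borel" by (simp add: A_def)
  define N where "N = density lborel (\<lambda>h. ennreal (normal_density 0 (sqrt s) h))"
  have [simp, measurable_cong]: "sets N = sets borel" by (simp add: N_def)
  have [simp]: "space N = UNIV" by (simp add: N_def)
  interpret N: prob_space N
    unfolding N_def using s by (intro prob_space_normal_density) auto
  define c where "c = emeasure N A"
  have c1: "c \<le> 1" unfolding c_def by (rule N.measure_le_1)
  have c_top: "c < top" using c1 by (rule le_less_trans) simp
  \<comment> \<open>The normal density is positive, so an \<open>N\<close>-null interval would be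
    Lebesgue-null, whereas \<open>A\<close> has length \<open>2 * H\<close>.\<close>
  have c0: "c \<noteq> 0"
  proof
    assume "c = 0"
    hence "A \<in> null_sets N" by (auto simp: c_def)
    hence "AE h in lborel. h \<notin> A"
      unfolding N_def using normal_density_pos[of "sqrt s" 0] s
      by (auto simp: null_sets_density_iff order.strict_iff_order)
    hence "A \<in> null_sets lborel"
      by (subst AE_iff_null_sets) auto
    thus False using H by (auto simp: A_def null_sets_def)
  qed
  define U where "U = uniform_measure N A"
  have U: "prob_space U" unfolding U_def by (rule prob_space_uniform_measure) (use c0 c1 in \<open>auto simp: c_def\<close>)
  have [simp, measurable_cong]: "sets U = sets borel" by (simp add: U_def)
  have [simp]: "space U = UNIV" by (simp add: U_def)
  have UA: "emeasure U A = 1"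
    unfolding U_def using c0 c1 by (subst emeasure_uniform_measure) (auto simp: c_def[symmetric] c_top)
  define \<pi> where "\<pi> = restrict_space U A"
  have prior: "\<pi> \<in> priors H"
    unfolding priors_def space_prob_algebra \<pi>_def
    using UA by (auto simp: A_def[symmetric] emeasure_restrict_space sets_restrict_space space_restrict_space
        intro!: prob_spaceI)
  interpret gauss_prior \<pi> H by unfold_locales (fact prior)
  have "s * v / (s + v) - 12 * s\<^sup>2 / H\<^sup>2 \<le> gauss_bayes_risk v \<pi>"
  proof (rule gauss_bayes_risk_ge[OF v])
    fix d :: "real \<Rightarrow> real" assume d[measurable]: "d \<in> borel_measurable borel"
    \<comment> \<open>Clipping \<open>d\<close> to the interval can only reduce the error for
      parameters inside \<open>A\<close>, and makes the risk outside controllable.\<close>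
    define e where "e y = max (-H) (min H (d y))" for y
    have e[measurable]: "e \<in> borel_measurable borel" unfolding e_def[abs_def] by measurable
    have m: "sq_risk (gauss_law v) d \<in> borel_measurable borel"
      "sq_risk (gauss_law v) e \<in> borel_measurable borel"
      using v by (auto intro: measurable_sq_risk_gauss_law)
    have mA: "(\<lambda>h. sq_risk (gauss_law v) d h * indicator A h) \<in> borel_measurable N"
      using m by (auto simp: N_def intro!: borel_measurable_times_ennreal borel_measurable_indicator)
    have inside: "sq_risk (gauss_law v) e h \<le> sq_risk (gauss_law v) d h" if "h \<in> A" for h
    proof -
      have "(e y - h)\<^sup>2 \<le> (d y - h)\<^sup>2" for y
        using that by (subst abs_le_square_iff[symmetric]) (auto simp: e_def A_def)
      thus ?thesis unfolding sq_risk_def by (intro nn_integral_mono ennreal_leI)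
    qed
    have outside: "sq_risk (gauss_law v) e h \<le> ennreal (4 * h ^ 4 / H\<^sup>2)" if "h \<notin> A" for h
    proof -
      have h: "H \<le> \<bar>h\<bar>" using that H by (auto simp: A_def)
      have "(e y - h)\<^sup>2 \<le> 4 * h ^ 4 / H\<^sup>2" for y
      proof -
        have "\<bar>e y\<bar> \<le> H" using H by (auto simp: e_def)
        hence "\<bar>e y - h\<bar> \<le> \<bar>2 * h\<bar>" using h by auto
        hence "(e y - h)\<^sup>2 \<le> (2 * h)\<^sup>2" by (subst abs_le_square_iff[symmetric])
        also have "\<dots> = 4 * h\<^sup>2 * 1" by (simp add: power_mult_distrib)
        \<comment> \<open>Outside \<open>A\<close> the extra factor is at least one. It produces a
          fourth power, whose normal moment \<open>3 * s\<^sup>2\<close> yields the constant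
          12.\<close>
        also have "\<dots> \<le> 4 * h\<^sup>2 * (h\<^sup>2 / H\<^sup>2)"
          using h H abs_le_square_iff[of H h] by (intro mult_left_mono) auto
        also have "\<dots> = 4 * h ^ 4 / H\<^sup>2" by (simp add: power2_eq_square power4_eq_xxxx)
        finally show ?thesis .
      qed
      hence "sq_risk (gauss_law v) e h \<le> (\<integral>\<^sup>+ y. ennreal (4 * h ^ 4 / H\<^sup>2) \<partial>gauss_law v h)"
        unfolding sq_risk_def by (intro nn_integral_mono ennreal_leI)
      also have "\<dots> = ennreal (4 * h ^ 4 / H\<^sup>2)"
        using prob_space.emeasure_space_1[OF prob_space_normal_density[of "sqrt v" h]] v
        by (simp add: gauss_law_def)
      finally show ?thesis .
    qed
    have "ennreal (s * v / (s + v)) \<le> (\<integral>\<^sup>+ h. sq_risk (gauss_law v) e h \<partial>N)"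
      using gaussian_prior_risk_ge[OF s v e] m unfolding N_def by (subst nn_integral_density) auto
    also have "\<dots> \<le> (\<integral>\<^sup>+ h. sq_risk (gauss_law v) d h * indicator A h + ennreal (4 * h ^ 4 / H\<^sup>2) \<partial>N)"
      using inside outside by (intro nn_integral_mono) (auto simp: indicator_def add_increasing2)
    also have "\<dots> = (\<integral>\<^sup>+ h. sq_risk (gauss_law v) d h * indicator A h \<partial>N) + (\<integral>\<^sup>+ h. ennreal (4 * h ^ 4 / H\<^sup>2) \<partial>N)"
      by (rule nn_integral_add) (use mA in \<open>auto simp: N_def\<close>)
    also have "(\<integral>\<^sup>+ h. ennreal (4 * h ^ 4 / H\<^sup>2) \<partial>N) = ennreal (12 * s\<^sup>2 / H\<^sup>2)"
    proof -
      have "has_bochner_integral lborel (\<lambda>h. 4 / H\<^sup>2 * (normal_density 0 (sqrt s) h * (h - 0) ^ 4))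
         (4 / H\<^sup>2 * (3 * s\<^sup>2))"
        by (intro has_bochner_integral_mult_right normal_density_fourth_moment s)
      hence "(\<integral>\<^sup>+ h. ennreal (4 / H\<^sup>2 * (normal_density 0 (sqrt s) h * (h - 0) ^ 4)) \<partial>lborel)
          = ennreal (4 / H\<^sup>2 * (3 * s\<^sup>2))"
        by (subst nn_integral_eq_integral) (auto simp: has_bochner_integral_iff)
      thus ?thesis unfolding N_def
        by (subst nn_integral_density) (auto simp: ennreal_mult'[symmetric] mult_ac)
    qed
    \<comment> \<open>Conditioning on \<open>A\<close> divides by its probability
      \<open>c \<le> 1\<close>, which only increases the integral.\<close>
    also have "(\<integral>\<^sup>+ h. sq_risk (gauss_law v) d h * indicator A h \<partial>N) \<le>
        (\<integral>\<^sup>+ h. sq_risk (gauss_law v) d h * indicator A h \<partial>N) / c"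
    proof -
      have "1 = c * inverse c" using c0 c_top by (simp flip: divide_ennreal_def)
      also have "\<dots> \<le> 1 * inverse c" using c1 by (rule mult_right_mono) simp
      finally have "1 \<le> inverse c" by simp
      from mult_left_mono[OF this] show ?thesis by (simp add: divide_ennreal_def)
    qed
    also have "\<dots> = (\<integral>\<^sup>+ h. sq_risk (gauss_law v) d h \<partial>\<pi>)"
    proof -
      have "(\<integral>\<^sup>+ h. sq_risk (gauss_law v) d h \<partial>\<pi>) = (\<integral>\<^sup>+ h. sq_risk (gauss_law v) d h * indicator A h \<partial>U)"
        unfolding \<pi>_def by (subst nn_integral_restrict_space) auto
      also have "\<dots> = (\<integral>\<^sup>+ h. sq_risk (gauss_law v) d h * indicator A h * indicator A h \<partial>N) / c"
        unfolding U_def c_def by (subst nn_integral_uniform_measure) (use mA in auto)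
      finally show ?thesis by (simp add: mult.assoc flip: indicator_inter_arith)
    qed
    finally show "ennreal (s * v / (s + v) - 12 * s\<^sup>2 / H\<^sup>2) \<le> (\<integral>\<^sup>+ h. sq_risk (gauss_law v) d h \<partial>\<pi>)"
      by (subst ennreal_diff_le_iff) auto
  qed
  with prior show ?thesis by blast
qed

section \<open>Increments of the minimax risk\<close>

definition sq_var_lip :: "real \<Rightarrow> real \<Rightarrow> real" where
  "sq_var_lip a b = 48 * (1 / a + b / a\<^sup>2) / a\<^sup>2 + 32 * b / a ^ 4"

text \<open>The first summand comes from the upper bound and the second from the lower bound. The
  terms \<open>b\<^sup>2 / sqrt h\<close> and \<open>12 / h\<close> are the shrinkage and tail
  losses of a truncated normal prior with variance parameter \<open>sqrt h\<close>.\<close>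

definition increment_error :: "real \<Rightarrow> real \<Rightarrow> real \<Rightarrow> real \<Rightarrow> real \<Rightarrow> real \<Rightarrow> real \<Rightarrow> real" where
  "increment_error a b t h \<delta> \<eta>0 \<eta>1 =
     (2 * \<eta>0 / t + 2 * \<eta>1 + sq_var_lip a b * (h ^ 4 * (t + \<delta>))) +
     2 / a * (\<delta> + b\<^sup>2 / sqrt h + 12 / h + 2 * \<eta>0)"

text \<open>A bound for one fixed \<open>n\<close>, by mean value arguments on
  \<open>[v, v + \<delta>]\<close> and, for the upper half, on the adjacent interval of length
  \<open>t\<close>. As \<open>K\<close> is an interval, it contains both.\<close>

lemma minimax_increment_bound:
  assumes T: "differentiated_gaussian_transfer K H C \<eta>0 \<eta>1 S P"
    and K: "is_interval K" "K \<subseteq> {a..b}" "0 < a"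
    and H: "0 < H n"
    and mem: "v \<in> K" "v + \<delta> \<in> K" "v + \<delta> + t \<in> K" and pos: "0 < \<delta>" "0 < t"
  shows "\<bar>minimax_risk (S n) (H n) (P n (v + \<delta>)) - minimax_risk (S n) (H n) (P n v) - \<delta>\<bar>
    \<le> increment_error a b t (H n) \<delta> (\<eta>0 n (H n)) (\<eta>1 n (H n)) * \<delta>"
proof -
  define h e0 e1 u where "h = H n" "e0 = \<eta>0 n (H n)" "e1 = \<eta>1 n (H n)" "u = v + \<delta>"
  note defs = this
  define r where "r = (\<lambda>x \<pi>. bayes_risk (S n) (P n x) \<pi>)"
  define R where "R = (\<lambda>x. minimax_risk (S n) (H n) (P n x))"
  define L where "L = sq_var_lip a b"
  define D0 where "D0 = b\<^sup>2 / sqrt h + 12 / h"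
  note T' = T[unfolded differentiated_gaussian_transfer_def, THEN spec, of n, THEN bspec]
  have h: "0 < h" using H by (simp add: defs)
  have K_pos: "0 < x" "x \<in> {a..b}" if "x \<in> K" for x using K(2,3) that by force+
  have K_mem: "z \<in> K" if "x \<in> K" "y \<in> K" "x \<le> z" "z \<le> y" for x y z
    using mem_is_interval_1_I[OF K(1)] that by blast
  have prior: "gauss_prior \<pi> h" if "\<pi> \<in> priors h" for \<pi> using that by (simp add: gauss_prior_def)
  have approx: "\<bar>r x \<pi> - gauss_bayes_risk x \<pi>\<bar> \<le> e0" if "x \<in> K" "\<pi> \<in> priors h" for x \<pi>
    using T' that unfolding r_def defs by blast
  have deriv: "\<exists>D. ((\<lambda>x. r x \<pi>) has_real_derivative D) (at x within K) \<and> 0 \<le> D \<and>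
      \<bar>D - gauss_prior.sq_var \<pi> x\<bar> \<le> e1"
    if x: "x \<in> K" and \<pi>: "\<pi> \<in> priors h" for x \<pi>
  proof -
    from T'[OF x] \<pi> obtain D where "((\<lambda>x. r x \<pi>) has_real_derivative D) (at x within K)" "0 \<le> D"
      "\<bar>D - gauss_expectation x \<pi> (\<lambda>y. (gauss_posterior_var x \<pi> y / x)\<^sup>2)\<bar> \<le> e1"
      unfolding r_def defs by meson
    thus ?thesis unfolding gauss_prior.sq_var_def[OF prior[OF \<pi>]] by blast
  qed
  have r_le: "r x \<pi> \<le> R x" if "x \<in> K" "\<pi> \<in> priors h" for x \<pi>
  proof -
    \<comment> \<open>A real-valued \<open>SUP\<close> dominates its members only over a bounded
      set; the bound comes from the Gaussian comparison.\<close>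
    have "r x \<pi> \<le> x + e0" if "\<pi> \<in> priors h" for \<pi>
      using approx[OF \<open>x \<in> K\<close> that] gauss_prior.gauss_bayes_risk_le[OF prior[OF that] K_pos(1)[OF \<open>x \<in> K\<close>]]
      by linarith
    hence "bdd_above (r x ` priors h)" by (intro bdd_aboveI2)
    moreover have "R x = (SUP \<pi>\<in>priors h. r x \<pi>)"
      using T'[OF \<open>x \<in> K\<close>] unfolding r_def R_def defs by (rule conjunct1)
    ultimately show ?thesis using that by (simp add: cSUP_upper)
  qed
  have least_favorable: "\<exists>\<pi>\<in>priors h. r x \<pi> = R x" if "x \<in> K" for x
    using T'[OF that] unfolding r_def R_def defs by (elim conjE)
  have mvt: "\<exists>\<xi> D. x < \<xi> \<and> \<xi> < y \<and> r y \<pi> - r x \<pi> = (y - x) * D \<and> 0 \<le> D \<and>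
      \<bar>D - gauss_prior.sq_var \<pi> \<xi>\<bar> \<le> e1"
    if xy: "x \<in> K" "y \<in> K" "x < y" and \<pi>: "\<pi> \<in> priors h" for x y \<pi>
  proof -
    have "\<forall>z\<in>K. \<exists>D. ((\<lambda>x. r x \<pi>) has_real_derivative D) (at z within K) \<and> 0 \<le> D \<and>
        \<bar>D - gauss_prior.sq_var \<pi> z\<bar> \<le> e1"
      using deriv[OF _ \<pi>] by blast
    from bchoice[OF this] obtain D where "\<forall>z\<in>K. ((\<lambda>x. r x \<pi>) has_real_derivative D z) (at z within K) \<and>
        0 \<le> D z \<and> \<bar>D z - gauss_prior.sq_var \<pi> z\<bar> \<le> e1" ..
    hence D: "\<And>z. z \<in> K \<Longrightarrow> ((\<lambda>x. r x \<pi>) has_real_derivative D z) (at z within K)"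
      "\<And>z. z \<in> K \<Longrightarrow> 0 \<le> D z" "\<And>z. z \<in> K \<Longrightarrow> \<bar>D z - gauss_prior.sq_var \<pi> z\<bar> \<le> e1"
      by simp_all
    \<comment> \<open>The derivative is given relative to \<open>K\<close>; restricting it to
      \<open>[x, y]\<close> brings it into the form of the mean value theorem.\<close>
    have sub: "{x..y} \<subseteq> K" using K_mem[OF xy(1,2)] by auto
    have "((\<lambda>x. r x \<pi>) has_derivative (*) (D z)) (at z within {x..y})" if "x \<le> z" "z \<le> y" for z
    proof -
      have "z \<in> K" using sub that by auto
      from DERIV_subset[OF D(1)[OF this] sub] show ?thesis by (simp add: has_field_derivative_def)
    qed
    from mvt_simple[OF \<open>x < y\<close> this] obtain \<xi> where
      "\<xi> \<in> {x<..<y}" "r y \<pi> - r x \<pi> = D \<xi> * (y - x)" by auto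
    moreover from this(1) sub have "\<xi> \<in> K" by auto
    ultimately show ?thesis using D(2,3)[of \<xi>]
      by - (rule exI[of _ \<xi>], rule exI[of _ "D \<xi>"], auto simp: mult.commute)
  qed
  have u: "u \<in> K" "u + t \<in> K" using mem by (auto simp: defs)
  have e0: "0 \<le> e0" and e1: "0 \<le> e1"
    using least_favorable[OF mem(1)] approx[OF mem(1)] deriv[OF mem(1)]
    by (meson abs_ge_zero order_trans)+
  have L: "0 \<le> L" using K_pos(2)[OF mem(1)] K(3) by (auto simp: L_def sq_var_lip_def)
  have D0: "0 \<le> D0" using h by (simp add: D0_def)
  let ?U = "2 * e0 / t + 2 * e1 + L * (h ^ 4 * (t + \<delta>))"
  let ?L = "2 / a * (\<delta> + D0 + 2 * e0)"

  \<comment> \<open>Scaling the prior costs the factor \<open>(u + t) / u\<close>, that is, an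
    excess of \<open>t\<close> times risk over \<open>u\<close>, and the Gaussian risk is at most
    \<open>u\<close>. The two passages between experiment and Gaussian reference cost
    \<open>2 * e0\<close>.\<close>
  have growth: "R (u + t) \<le> R u + t + 2 * e0"
  proof -
    obtain \<pi> where \<pi>: "\<pi> \<in> priors h" "r (u + t) \<pi> = R (u + t)" using least_favorable[OF u(2)] by blast
    obtain \<pi>' where \<pi>': "\<pi>' \<in> priors h"
      "gauss_bayes_risk (u + t) \<pi> \<le> (u + t) / u * gauss_bayes_risk u \<pi>'"
      using gauss_prior.ex_scaled_prior[OF prior[OF \<pi>(1)], of u "u + t"] K_pos(1)[OF u(1)] pos by auto
    have "(u + t) / u * gauss_bayes_risk u \<pi>' = gauss_bayes_risk u \<pi>' + t * (gauss_bayes_risk u \<pi>' / u)"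
      using K_pos(1)[OF u(1)] by (simp add: field_simps)
    also have "\<dots> \<le> gauss_bayes_risk u \<pi>' + t * 1"
      using gauss_prior.gauss_bayes_risk_le[OF prior[OF \<pi>'(1)] K_pos(1)[OF u(1)]] K_pos(1)[OF u(1)] pos
      by (intro add_left_mono mult_left_mono) auto
    finally show ?thesis
      using \<pi> \<pi>' approx[OF u(2) \<pi>(1)] approx[OF u(1) \<pi>'(1)] r_le[OF u(1) \<pi>'(1)] by linarith
  qed

  \<comment> \<open>One prior serves both intervals. Being optimal at \<open>u\<close>, its risk
    rises on \<open>[v, u]\<close> at least as much as the minimax risk and on
    \<open>[u, u + t]\<close> at most as much.\<close>
  have upper: "R u - R v \<le> \<delta> * (1 + ?U)"
  proof -
    obtain \<pi> where \<pi>: "\<pi> \<in> priors h" "r u \<pi> = R u" using least_favorable[OF u(1)] by blast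
    interpret gauss_prior \<pi> h by (rule prior[OF \<pi>(1)])
    obtain \<xi>1 D1 where 1: "v < \<xi>1" "\<xi>1 < u" "r u \<pi> - r v \<pi> = (u - v) * D1" "\<bar>D1 - sq_var \<xi>1\<bar> \<le> e1"
      using mvt[OF mem(1) u(1) _ \<pi>(1)] pos by (auto simp: defs)
    obtain \<xi>2 D2 where 2: "u < \<xi>2" "\<xi>2 < u + t" "r (u + t) \<pi> - r u \<pi> = t * D2" "\<bar>D2 - sq_var \<xi>2\<bar> \<le> e1"
      using mvt[OF u _ \<pi>(1)] pos by auto
    have "t * D2 \<le> t + 2 * e0" using 2(3) growth r_le[OF u(2) \<pi>(1)] \<pi>(2) by linarith
    hence D2: "D2 \<le> 1 + 2 * e0 / t" using pos by (simp add: field_simps)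
    have \<xi>K: "\<xi>1 \<in> K" "\<xi>2 \<in> K"
      using K_mem[OF mem(1) u(1)] K_mem[OF u] 1 2 by auto
    have "\<bar>sq_var \<xi>1 - sq_var \<xi>2\<bar> \<le> L * h ^ 4 * \<bar>\<xi>1 - \<xi>2\<bar>"
      unfolding L_def sq_var_lip_def by (intro sq_var_lipschitz K(3) K_pos \<xi>K)
    also have "\<dots> \<le> L * h ^ 4 * (t + \<delta>)"
      using 1 2 L h by (intro mult_left_mono) (auto simp: defs)
    finally have "D1 \<le> 1 + ?U" using 1(4) 2(4) D2 by (simp add: mult.assoc)
    hence "\<delta> * D1 \<le> \<delta> * (1 + ?U)" using pos by (intro mult_left_mono) auto
    thus ?thesis using 1(3) \<pi>(2) r_le[OF mem(1) \<pi>(1)] by (simp add: defs)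
  qed

  have lower: "\<delta> * (1 - (?L + e1)) \<le> R u - R v"
  proof -
    obtain \<pi> where \<pi>: "\<pi> \<in> priors h" "r v \<pi> = R v" using least_favorable[OF mem(1)] by blast
    interpret gauss_prior \<pi> h by (rule prior[OF \<pi>(1)])
    obtain \<xi> D where 1: "v < \<xi>" "\<xi> < u" "r u \<pi> - r v \<pi> = (u - v) * D" "\<bar>D - sq_var \<xi>\<bar> \<le> e1"
      using mvt[OF mem(1) u(1) _ \<pi>(1)] pos by (auto simp: defs)
    have \<xi>K: "\<xi> \<in> K" using K_mem[OF mem(1) u(1)] 1 by auto
    \<comment> \<open>The sign condition on the derivative carries the risk at \<open>v\<close>
      forward to \<open>\<xi>\<close>.\<close>
    have mono: "r v \<pi> \<le> r \<xi> \<pi>" using mvt[OF mem(1) \<xi>K 1(1) \<pi>(1)] 1(1)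
      by (metis diff_ge_0_iff_ge less_imp_le mult_nonneg_nonneg)
    \<comment> \<open>The variance parameter \<open>s = sqrt h\<close> balances two losses:
      \<open>v\<^sup>2 / (s + v)\<close> needs \<open>s\<close> large, while
      \<open>12 * s\<^sup>2 / h\<^sup>2\<close> needs \<open>s\<close> small compared with
      \<open>h\<close>.\<close>
    obtain \<pi>0 where \<pi>0: "\<pi>0 \<in> priors h"
      "sqrt h * v / (sqrt h + v) - 12 * (sqrt h)\<^sup>2 / h\<^sup>2 \<le> gauss_bayes_risk v \<pi>0"
      using ex_prior_risk_ge[OF h, of "sqrt h" v] h K_pos[OF mem(1)] by auto
    have "v - D0 \<le> sqrt h * v / (sqrt h + v) - 12 * (sqrt h)\<^sup>2 / h\<^sup>2"
    proof -
      have sh: "0 < sqrt h" using h by simp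
      have v: "0 < v" "v \<le> b" using K_pos[OF mem(1)] by auto
      have "sqrt h * v / (sqrt h + v) = v - v\<^sup>2 / (sqrt h + v)"
      proof -
        have nz: "sqrt h + v \<noteq> 0" using sh v by linarith
        have "sqrt h * v = v * (sqrt h + v) - v\<^sup>2" by (simp add: power2_eq_square algebra_simps)
        thus ?thesis using nz by (simp add: diff_divide_distrib)
      qed
      moreover have "v\<^sup>2 / (sqrt h + v) \<le> b\<^sup>2 / sqrt h"
        using sh v by (intro frac_le power_mono) auto
      moreover have "12 * (sqrt h)\<^sup>2 / h\<^sup>2 = 12 / h" using h by (simp add: power2_eq_square)
      ultimately show ?thesis by (simp add: D0_def)
    qed
    \<comment> \<open>The chain runs from the Gaussian risk of \<open>\<pi>0\<close> to its
      experiment risk, to \<open>R v = r v \<pi>\<close>, to \<open>r \<xi> \<pi>\<close>, and back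
      to a Gaussian risk; the two passages between models cost \<open>2 * e0\<close>.\<close>
    hence "v - D0 - 2 * e0 \<le> gauss_bayes_risk \<xi> \<pi>"
      using \<pi>0(2) approx[OF mem(1) \<pi>0(1)] r_le[OF mem(1) \<pi>0(1)] \<pi>(2) mono approx[OF \<xi>K \<pi>(1)]
      by linarith
    hence "\<xi> - (\<delta> + D0 + 2 * e0) \<le> gauss_bayes_risk \<xi> \<pi>" using 1(2) by (simp add: defs)
    hence "2 * (\<xi> - (\<delta> + D0 + 2 * e0)) / \<xi> - 1 \<le> 2 * gauss_bayes_risk \<xi> \<pi> / \<xi> - 1"
      using K_pos[OF \<xi>K] by (intro diff_right_mono divide_right_mono) auto
    also have "\<dots> \<le> sq_var \<xi>" by (intro sq_var_ge K_pos \<xi>K)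
    finally have "1 - 2 / \<xi> * (\<delta> + D0 + 2 * e0) \<le> sq_var \<xi>"
      using K_pos[OF \<xi>K] by (simp add: field_simps)
    moreover have "2 / \<xi> * (\<delta> + D0 + 2 * e0) \<le> ?L"
      using K_pos[OF \<xi>K] K(3) pos D0 e0 by (intro mult_right_mono divide_left_mono) auto
    ultimately have "1 - (?L + e1) \<le> D" using 1(4) by linarith
    hence "\<delta> * (1 - (?L + e1)) \<le> \<delta> * D" using pos by (intro mult_left_mono) auto
    thus ?thesis using 1(3) \<pi>(2) r_le[OF u(1) \<pi>(1)] by (simp add: defs)
  qed

  have nonneg: "0 \<le> 2 * e0 / t" "0 \<le> L * (h ^ 4 * (t + \<delta>))" "0 \<le> ?L"
    using e0 L h pos D0 K(3) by auto
  have "\<bar>R u - R v - \<delta>\<bar> \<le> (?U + ?L) * \<delta>"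
  proof -
    \<comment> \<open>Both one-sided errors are enlarged to their sum; the \<open>2 * e1\<close>
      inside \<open>?U\<close> covers the \<open>e1\<close> of the lower bound.\<close>
    have "\<delta> * (1 + ?U) \<le> \<delta> * (1 + (?U + ?L))" "\<delta> * (1 - (?U + ?L)) \<le> \<delta> * (1 - (?L + e1))"
      using nonneg pos e1 by (intro mult_left_mono; simp)+
    with upper lower have "R u - R v \<le> \<delta> * (1 + (?U + ?L))" "\<delta> * (1 - (?U + ?L)) \<le> R u - R v"
      by (blast intro: order_trans)+
    moreover have "\<bar>A - \<delta>\<bar> \<le> x * \<delta>" if "A \<le> \<delta> * (1 + x)" "\<delta> * (1 - x) \<le> A" for A x
      using that by (simp add: abs_le_iff algebra_simps)
    ultimately show ?thesis by blast
  qed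
  thus ?thesis
    by (simp add: increment_error_def R_def L_def D0_def defs add.assoc)
qed

section \<open>Vanishing of the error along the sequence\<close>

text \<open>With \<open>t = 1 / H ^ 5\<close> the critical terms become \<open>H ^ 5 * e0\<close>,
  \<open>1 / H\<close> and \<open>H ^ 4 * \<delta>\<close>. Once \<open>H \<ge> 1\<close>, lower
  powers of \<open>H\<close> inherit the given rates.\<close>

lemma tendsto_increment_error:
  fixes H \<delta> e0 e1 :: "nat \<Rightarrow> real"
  assumes H: "filterlim H at_top sequentially"
    and e0: "(\<lambda>n. H n ^ 6 * e0 n) \<longlonglongrightarrow> 0" and e1: "e1 \<longlonglongrightarrow> 0"
    and delta: "\<delta> \<longlonglongrightarrow> 0" "(\<lambda>n. H n ^ 10 * \<delta> n) \<longlonglongrightarrow> 0"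
  shows "(\<lambda>n. increment_error a b (1 / H n ^ 5) (H n) (\<delta> n) (e0 n) (e1 n)) \<longlonglongrightarrow> 0"
proof -
  have H1: "\<forall>\<^sub>F n in sequentially. 1 \<le> H n" using H by (simp add: filterlim_at_top)
  have lower_power: "(\<lambda>n. H n ^ j * f n) \<longlonglongrightarrow> 0"
    if "(\<lambda>n. H n ^ k * f n) \<longlonglongrightarrow> 0" "j \<le> k" for j k and f :: "nat \<Rightarrow> real"
  proof (rule Lim_null_comparison[OF _ tendsto_rabs_zero[OF that(1)]])
    show "\<forall>\<^sub>F n in sequentially. norm (H n ^ j * f n) \<le> \<bar>H n ^ k * f n\<bar>"
      using H1 by eventually_elim (use that(2) in \<open>auto simp: abs_mult intro!: mult_right_mono power_increasing\<close>)
  qed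
  have e0': "(\<lambda>n. H n ^ 5 * e0 n) \<longlonglongrightarrow> 0" "e0 \<longlonglongrightarrow> 0"
    using lower_power[OF e0, of 5] lower_power[OF e0, of 0] by auto
  have d4: "(\<lambda>n. H n ^ 4 * \<delta> n) \<longlonglongrightarrow> 0" using lower_power[OF delta(2), of 4] by auto
  have inv: "(\<lambda>n. c / H n) \<longlonglongrightarrow> 0" for c
    by (intro tendsto_divide_0[OF tendsto_const] filterlim_at_top_imp_at_infinity H)
  have inv_sqrt: "(\<lambda>n. c / sqrt (H n)) \<longlonglongrightarrow> 0" for c
    by (intro tendsto_divide_0[OF tendsto_const] filterlim_at_top_imp_at_infinity
        filterlim_compose[OF sqrt_at_top H])
  have "(\<lambda>n. (2 * (H n ^ 5 * e0 n) + 2 * e1 n + sq_var_lip a b * (1 / H n + H n ^ 4 * \<delta> n)) +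
     2 / a * (\<delta> n + b\<^sup>2 / sqrt (H n) + 12 / H n + 2 * e0 n)) \<longlonglongrightarrow>
     (2 * 0 + 2 * 0 + sq_var_lip a b * (0 + 0)) + 2 / a * (0 + 0 + 0 + 2 * 0)"
    by (intro tendsto_intros e0' e1 d4 inv inv_sqrt delta)
  hence "(\<lambda>n. (2 * (H n ^ 5 * e0 n) + 2 * e1 n + sq_var_lip a b * (1 / H n + H n ^ 4 * \<delta> n)) +
     2 / a * (\<delta> n + b\<^sup>2 / sqrt (H n) + 12 / H n + 2 * e0 n)) \<longlonglongrightarrow> 0" by simp
  moreover have "\<forall>\<^sub>F n in sequentially.
     (2 * (H n ^ 5 * e0 n) + 2 * e1 n + sq_var_lip a b * (1 / H n + H n ^ 4 * \<delta> n)) +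
     2 / a * (\<delta> n + b\<^sup>2 / sqrt (H n) + 12 / H n + 2 * e0 n) =
     increment_error a b (1 / H n ^ 5) (H n) (\<delta> n) (e0 n) (e1 n)"
    using H1
  proof eventually_elim
    case (elim n)
    have "H n ^ 4 * (1 / H n ^ 5 + \<delta> n) = 1 / H n + H n ^ 4 * \<delta> n"
      using elim by (simp add: distrib_left field_simps power_Suc[symmetric] eval_nat_numeral)
    thus ?case by (simp add: increment_error_def mult_ac)
  qed
  ultimately show ?thesis by (rule Lim_transform_eventually)
qed

section \<open>Uniform and sequential asymptotics of the minimax increment\<close>

theorem theorem4p5:
  fixes K K\<^sub>0 :: "real set" and H \<delta> :: "nat \<Rightarrow> real" and C :: real
    and \<eta>0 \<eta>1 :: "nat \<Rightarrow> real \<Rightarrow> real"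
  assumes K: "compact K" "is_interval K" "K \<subseteq> {0<..}"
    and K0: "compact K\<^sub>0" "K\<^sub>0 \<subseteq> interior K"
    and delta: "decseq \<delta>" "\<delta> \<longlonglongrightarrow> 0"
    and H: "\<And>n. 0 < H n" "filterlim H at_top sequentially"
    and rates: "(\<lambda>n. H n ^ 6 * \<eta>0 n (H n)) \<longlonglongrightarrow> 0"
      "(\<lambda>n. \<eta>1 n (H n)) \<longlonglongrightarrow> 0"
      "(\<lambda>n. H n ^ 10 * \<delta> n) \<longlonglongrightarrow> 0"
  shows
    "(\<forall>(S :: nat \<Rightarrow> 'a measure) P v.
       (\<forall>n. \<forall>u\<in>K. local_experiment (S n) (H n) (P n u)) \<and>
       differentiated_gaussian_transfer K H C \<eta>0 \<eta>1 S P \<and>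
       (\<forall>n. {v n..v n + \<delta> n} \<subseteq> K\<^sub>0) \<longrightarrow>
       (\<exists>e. e \<longlonglongrightarrow> 0 \<and>
          (\<forall>n. minimax_risk (S n) (H n) (P n (v n + \<delta> n)) - minimax_risk (S n) (H n) (P n (v n))
                 = \<delta> n * (1 + e n)))) \<and>
     (\<forall>\<epsilon>>0. \<exists>N. \<forall>(S :: nat \<Rightarrow> 'a measure) P v.
       (\<forall>n. \<forall>u\<in>K. local_experiment (S n) (H n) (P n u)) \<and>
       differentiated_gaussian_transfer K H C \<eta>0 \<eta>1 S P \<and>
       (\<forall>n. {v n..v n + \<delta> n} \<subseteq> K\<^sub>0) \<longrightarrow>
       (\<forall>n\<ge>N. \<bar>minimax_risk (S n) (H n) (P n (v n + \<delta> n)) - minimax_risk (S n) (H n) (P n (v n))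
                 - \<delta> n\<bar> \<le> \<epsilon> * \<delta> n))"
    (is "?pointwise \<and> ?uniform")
proof -
  have delta_nonneg: "0 \<le> \<delta> n" for n using decseq_ge[OF delta] .
  obtain a b where ab: "0 < a" "K \<subseteq> {a..b}"
  proof (cases "K = {}")
    case False
    then obtain a b where "a \<in> K" "\<forall>x\<in>K. a \<le> x" "\<forall>x\<in>K. x \<le> b"
      using compact_attains_inf[OF K(1)] compact_attains_sup[OF K(1)] by metis
    thus ?thesis using K(3) by (intro that[of a b]) auto
  qed (use that[of 1 1] in auto)
  \<comment> \<open>Compactness gives a uniform margin around \<open>K\<^sub>0\<close> inside
    \<open>K\<close>, which leaves room for the auxiliary point
    \<open>v n + \<delta> n + 1 / H n ^ 5\<close>.\<close>
  obtain \<rho> where \<rho>: "0 < \<rho>" "(\<Union>x\<in>K\<^sub>0. ball x \<rho>) \<subseteq> interior K"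
    using compact_subset_open_imp_ball_epsilon_subset[OF K0(1) open_interior K0(2)] by blast
  define E where "E n = increment_error a b (1 / H n ^ 5) (H n) (\<delta> n) (\<eta>0 n (H n)) (\<eta>1 n (H n))" for n
  have E: "E \<longlonglongrightarrow> 0"
    unfolding E_def using tendsto_increment_error[OF H(2) rates(1,2) delta(2) rates(3)] by simp
  have uniform: ?uniform
  proof (intro allI impI)
    fix \<epsilon> :: real assume "0 < \<epsilon>"
    have "(\<lambda>n. 1 / H n ^ 5) \<longlonglongrightarrow> 0"
      by (intro tendsto_divide_0[OF tendsto_const] filterlim_at_top_imp_at_infinity filterlim_pow_at_top H(2)) simp
    hence "\<forall>\<^sub>F n in sequentially. 1 / H n ^ 5 < \<rho>" using \<rho>(1) by (rule order_tendstoD)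
    moreover have "\<forall>\<^sub>F n in sequentially. E n < \<epsilon>" using E \<open>0 < \<epsilon>\<close> by (rule order_tendstoD)
    \<comment> \<open>Neither \<open>\<rho>\<close> nor \<open>E\<close> refers to the experiments
      or to \<open>v\<close>, so the threshold is fixed before they are chosen.\<close>
    ultimately have "\<forall>\<^sub>F n in sequentially. 1 / H n ^ 5 < \<rho> \<and> E n < \<epsilon>" by eventually_elim simp
    then obtain N where N: "\<And>n. n \<ge> N \<Longrightarrow> 1 / H n ^ 5 < \<rho> \<and> E n < \<epsilon>"
      by (auto simp: eventually_sequentially)
    show "\<exists>N. \<forall>(S :: nat \<Rightarrow> 'a measure) P v.
       (\<forall>n. \<forall>u\<in>K. local_experiment (S n) (H n) (P n u)) \<and>
       differentiated_gaussian_transfer K H C \<eta>0 \<eta>1 S P \<and>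
       (\<forall>n. {v n..v n + \<delta> n} \<subseteq> K\<^sub>0) \<longrightarrow>
       (\<forall>n\<ge>N. \<bar>minimax_risk (S n) (H n) (P n (v n + \<delta> n)) - minimax_risk (S n) (H n) (P n (v n))
                 - \<delta> n\<bar> \<le> \<epsilon> * \<delta> n)"
    proof (intro exI[of _ N] allI impI, elim conjE)
      fix S :: "nat \<Rightarrow> 'a measure" and P v n
      assume T: "differentiated_gaussian_transfer K H C \<eta>0 \<eta>1 S P"
        and v: "\<forall>n. {v n..v n + \<delta> n} \<subseteq> K\<^sub>0" and n: "N \<le> n"
      show "\<bar>minimax_risk (S n) (H n) (P n (v n + \<delta> n)) - minimax_risk (S n) (H n) (P n (v n)) - \<delta> n\<bar>
          \<le> \<epsilon> * \<delta> n"
      \<comment> \<open>The increment bound divides the work into nondegenerate intervals; for a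
        zero step both sides vanish.\<close>
      proof (cases "\<delta> n = 0")
        case False
        hence d: "0 < \<delta> n" using delta_nonneg[of n] by simp
        have "{v n..v n + \<delta> n} \<subseteq> K\<^sub>0" using v by blast
        hence K0_mem: "v n \<in> K\<^sub>0" "v n + \<delta> n \<in> K\<^sub>0" using d by auto
        have "v n + \<delta> n + 1 / H n ^ 5 \<in> ball (v n + \<delta> n) \<rho>"
          using N[OF n] H(1)[of n] by (simp add: dist_real_def)
        hence "v n + \<delta> n + 1 / H n ^ 5 \<in> K" using \<rho>(2) K0_mem interior_subset by blast
        moreover have "v n \<in> K" "v n + \<delta> n \<in> K" using K0_mem K0(2) interior_subset by blast+
        ultimately have "\<bar>minimax_risk (S n) (H n) (P n (v n + \<delta> n)) - minimax_risk (S n) (H n) (P n (v n)) - \<delta> n\<bar>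
            \<le> E n * \<delta> n"
          unfolding E_def using d H(1)[of n] by (intro minimax_increment_bound[OF T K(2) ab(2,1)]) auto
        also have "\<dots> \<le> \<epsilon> * \<delta> n" using N[OF n] d by (intro mult_right_mono) auto
        finally show ?thesis .
      qed simp
    qed
  qed
  have ?pointwise
  proof (intro allI impI)
    fix S :: "nat \<Rightarrow> 'a measure" and P v
    assume *: "(\<forall>n. \<forall>u\<in>K. local_experiment (S n) (H n) (P n u)) \<and>
       differentiated_gaussian_transfer K H C \<eta>0 \<eta>1 S P \<and> (\<forall>n. {v n..v n + \<delta> n} \<subseteq> K\<^sub>0)"
    define \<Delta> where "\<Delta> n = minimax_risk (S n) (H n) (P n (v n + \<delta> n)) - minimax_risk (S n) (H n) (P n (v n))" for n
    \<comment> \<open>If \<open>\<delta> n = 0\<close> the increment is zero and 0 is a convenient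
      value. Otherwise the equation forces this quotient.\<close>
    define e where "e n = (if \<delta> n = 0 then 0 else \<Delta> n / \<delta> n - 1)" for n
    have "e \<longlonglongrightarrow> 0"
    proof (rule LIMSEQ_I)
      fix \<epsilon> :: real assume "0 < \<epsilon>"
      \<comment> \<open>Halving turns the non-strict uniform bound into the strict inequality
        required for convergence.\<close>
      hence "0 < \<epsilon> / 2" by simp
      with uniform * obtain N where N: "\<And>n. n \<ge> N \<Longrightarrow> \<bar>\<Delta> n - \<delta> n\<bar> \<le> \<epsilon> / 2 * \<delta> n"
        unfolding \<Delta>_def by meson
      have "\<bar>e n\<bar> < \<epsilon>" if "n \<ge> N" for n
      proof (cases "\<delta> n = 0")
        case False
        hence d: "0 < \<delta> n" using delta_nonneg[of n] by simp
        have "e n = (\<Delta> n - \<delta> n) / \<delta> n" using d by (simp add: e_def diff_divide_distrib)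
        hence "\<bar>e n\<bar> = \<bar>\<Delta> n - \<delta> n\<bar> / \<delta> n" using d by simp
        also have "\<dots> \<le> \<epsilon> / 2" using N[OF that] d by (simp add: divide_le_eq)
        finally show ?thesis using \<open>0 < \<epsilon>\<close> by simp
      qed (use \<open>0 < \<epsilon>\<close> in \<open>simp add: e_def\<close>)
      thus "\<exists>N. \<forall>n\<ge>N. norm (e n - 0) < \<epsilon>" by auto
    qed
    moreover have "\<Delta> n = \<delta> n * (1 + e n)" for n
      by (simp add: e_def \<Delta>_def)
    ultimately show "\<exists>e. e \<longlonglongrightarrow> 0 \<and>
          (\<forall>n. minimax_risk (S n) (H n) (P n (v n + \<delta> n)) - minimax_risk (S n) (H n) (P n (v n))
                 = \<delta> n * (1 + e n))"
      unfolding \<Delta>_def by blast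
  qed
  with uniform show ?thesis by blast
qed

end
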